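(* Suppose $2\leq k\leq n$ are integers and $f:V(C_n)\to\{1,\ldots,k\}$ is a $k$-color weak maximizer of $W$ on $C_n$. (1) If $n$ is even, then $W(f)=\min\{W(f') : f'\in\mathrm{WM}_k(C_n)\}$ if and only if $\mathrm{type}(f)\in\mathcal{R}^\infty(\{t(n,k)\})$. (2) If $n$ is odd, then $W(f)=\min\{W(f') : f'\in\mathrm{WM}_k(C_n)\}$ if and only if the numbers of vertices in any two color classes of $f$ differ by at most one.
   Context: $C_n$ is the cycle on $n$ vertices (vertices $0,\ldots,n-1$, with distinct vertices $i,j$ adjacent iff $i-j\equiv\pm1\pmod n$). For a finite simple connected graph $G$ and $A\subseteq V(G)$, $W(A)=\sum_{\{u,v\}\in\binom{A}{2}}d_G(u,v)$, with $d_G$ the shortest-path distance. A $k$-coloring of $G$ is any function $f:V(G)\to\{1,\ldots,k\}$; its color classes are the sets $f^{-1}(i)$, $1\leq i\leq k$; $\mathrm{type}(f)$ is the $k$-tuple of the cardinalities $|f^{-1}(1)|,\ldots,|f^{-1}(k)|$ arranged in non-decreasing order, and $W(f)=\sum_{i=1}^k W(f^{-1}(i))$. For $k\geq 2$, $f$ is a $k$-color weak maximizer of $W$ on $G$ if $f$ is surjective and $W(f)\geq W(f')$ for all surjective $f':V(G)\to\{1,\ldots,k\}$ with $\mathrm{type}(f')=\mathrm{type}(f)$. $\mathrm{WM}_k(G)$ is the set of all $k$-color weak maximizers of $W$ on $G$. $t(n,k)=(m_1,\ldots,m_k)$ is the unique $k$-tuple of positive integers with $\sum_{j=1}^k m_j=n$,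 $m_1\leq\cdots\leq m_k$, and $|m_j-m_{j'}|\leq1$ for all $j,j'$. $\mathbb{Z}^k_\uparrow$ is the set of non-decreasing $k$-tuples of integers. For $1\leq j\leq j'\leq k$ and $x\in\mathbb{Z}^k_\uparrow$, $R_{j,j'}(x)$ is the tuple obtained from $x$ by subtracting $1$ from the $j$th entry, adding $1$ to the $j'$th entry, and rearranging the result in non-decreasing order. For $T\subseteq\mathbb{Z}^k_\uparrow$, $\mathcal{R}(T)$ is the set of all $s\in\mathbb{Z}^k_\uparrow$ such that $s\in T$, or $s=R_{j,j'}(t)$ for some $t=(n_1,\ldots,n_k)\in T$ and $1\leq j\leq j'\leq k$ with $n_j$ and $n_{j'}$ even and equal. Put $\mathcal{R}^1(T)=\mathcal{R}(T)$, $\mathcal{R}^{\ell+1}(T)=\mathcal{R}(\mathcal{R}^\ell(T))$ for $\ell\geq1$, and $\mathcal{R}^\infty(T)=\bigcup_{\ell=1}^\infty\mathcal{R}^\ell(T)$. *)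

theory Defs
  imports
    "Graph_Theory.Graph_Theory"
    "HOL-Library.FuncSet"
    "HOL-Number_Theory.Cong"
begin

text \<open>
  Graphs are those of the session Graph_Theory, where a finite simple graph is a finite symmetric
  loop-free digraph without parallel arcs (locale \<open>graph\<close>).
\<close>

definition cycle_graph :: "nat \<Rightarrow> (nat, nat \<times> nat) pre_digraph" where
  "cycle_graph n = with_proj \<lparr> pverts = {0..<n},
     parcs = {(i, j). i < n \<and> j < n \<and> i \<noteq> j \<and>
       ([int i - int j = 1] (mod int n) \<or> [int i - int j = -1] (mod int n))} \<rparr>"

text \<open>For vertices in different components the value below is an arbitrary number.\<close>

definition gdist :: "('a, 'b) pre_digraph \<Rightarrow> 'a \<Rightarrow> 'a \<Rightarrow> nat" where
  "gdist G u v = (LEAST l. \<exists>p. pre_digraph.awalk G u p v \<and> length p = l)"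

text \<open>
  The sum runs over the unordered pairs of distinct elements of \<open>A\<close>: the pair \<open>{u, v}\<close>, on which
  the (symmetric) distance is well-defined, is represented by \<open>(u, v)\<close> with \<open>u < v\<close>.
\<close>

definition wiener :: "('a::linorder, 'b) pre_digraph \<Rightarrow> 'a set \<Rightarrow> nat" where
  "wiener G A = (\<Sum>(u, v)\<in>{(u, v). u \<in> A \<and> v \<in> A \<and> u < v}. gdist G u v)"

text \<open>
  Functions defined on \<open>verts G\<close> only are rendered by the extensional function space of
  FuncSet, so that there are finitely many colorings of a finite graph.
\<close>

definition colorings :: "('a, 'b) pre_digraph \<Rightarrow> nat \<Rightarrow> ('a \<Rightarrow> nat) set" where
  "colorings G k = verts G \<rightarrow>\<^sub>E {1..k}"

definition surj_colorings :: "('a, 'b) pre_digraph \<Rightarrow> nat \<Rightarrow> ('a \<Rightarrow> nat) set" where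
  "surj_colorings G k = {f \<in> colorings G k. f ` verts G = {1..k}}"

definition color_class :: "('a, 'b) pre_digraph \<Rightarrow> ('a \<Rightarrow> nat) \<Rightarrow> nat \<Rightarrow> 'a set" where
  "color_class G f i = {v \<in> verts G. f v = i}"

definition color_type :: "('a, 'b) pre_digraph \<Rightarrow> nat \<Rightarrow> ('a \<Rightarrow> nat) \<Rightarrow> int list" where
  "color_type G k f = sort (map (\<lambda>i. int (card (color_class G f i))) [1..<Suc k])"

definition color_wiener :: "('a::linorder, 'b) pre_digraph \<Rightarrow> nat \<Rightarrow> ('a \<Rightarrow> nat) \<Rightarrow> nat" where
  "color_wiener G k f = (\<Sum>i = 1..k. wiener G (color_class G f i))"

definition weak_maximizers :: "('a::linorder, 'b) pre_digraph \<Rightarrow> nat \<Rightarrow> ('a \<Rightarrow> nat) set" where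
  "weak_maximizers G k = {f \<in> surj_colorings G k.
     \<forall>f' \<in> surj_colorings G k. color_type G k f' = color_type G k f \<longrightarrow>
       color_wiener G k f' \<le> color_wiener G k f}"

definition equitable_tuple :: "nat \<Rightarrow> nat \<Rightarrow> int list" where
  "equitable_tuple n k = (THE m. length m = k \<and> (\<forall>j<k. 0 < m ! j) \<and> sum_list m = int n \<and>
     sorted m \<and> (\<forall>j<k. \<forall>j'<k. \<bar>m ! j - m ! j'\<bar> \<le> 1))"

definition sorted_tuples :: "nat \<Rightarrow> int list set" where
  "sorted_tuples k = {x. length x = k \<and> sorted x}"

text \<open>
  Positions in tuples are counted from 0. The two updates are made one after the other, so that
  \<open>shift_unit j j x\<close> is \<open>sort x\<close>.
\<close>

definition shift_unit :: "nat \<Rightarrow> nat \<Rightarrow> int list \<Rightarrow> int list" where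
  "shift_unit j j' x = (let y = x[j := x ! j - 1] in sort (y[j' := y ! j' + 1]))"

definition shift_step :: "nat \<Rightarrow> int list set \<Rightarrow> int list set" where
  "shift_step k T = {s \<in> sorted_tuples k. s \<in> T \<or>
     (\<exists>t \<in> T. \<exists>j j'. j \<le> j' \<and> j' < k \<and> even (t ! j) \<and> even (t ! j') \<and> t ! j = t ! j' \<and>
        s = shift_unit j j' t)}"

definition shift_closure :: "nat \<Rightarrow> int list set \<Rightarrow> int list set" where
  "shift_closure k T = (\<Union>l\<in>{1..}. (shift_step k ^^ l) T)"

end

theory Submission
  imports Defs
begin

text \<open>
  Write \<open>h = n div 2\<close> and call the sets of \<open>h\<close> cyclically consecutive vertices the windows of
  \<open>C\<^sub>n\<close>. Two vertices at distance \<open>d\<close> are separated by exactly \<open>2 d\<close> of the \<open>n\<close> windows, so double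
  counting expresses \<open>W(A)\<close> for a set \<open>A\<close> of \<open>m\<close> vertices through the imbalances
  \<open>c\<^sub>i = 2 |A \<inter> H\<^sub>i| - m\<close> over the windows \<open>H\<^sub>i\<close>:
  \<open>8 W(A) = n m\<^sup>2 - (\<Sum>i. c\<^sub>i\<^sup>2)\<close> (\<open>wiener_cycle_imbalance\<close>). Hence \<open>W(A)\<close> is large when \<open>A\<close> is spread
  evenly. If \<open>m\<close> is odd, all \<open>c\<^sub>i\<close> are odd, and the squares sum to at least \<open>n\<close>. If \<open>m\<close> is even and
  \<open>n\<close> is odd, every vertex \<open>v\<close> is the only one outside two disjoint windows; when \<open>v \<in> A\<close> their
  imbalances add up to \<open>-2\<close> and cannot both vanish, which forces a sum of at least \<open>2 m\<close>. This is
  the upper bound \<open>wiener_cycle_le\<close>.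

  All color classes can attain their upper bounds at the same time, whatever their prescribed sizes.
  List the vertices in the order \<open>0, \<lceil>n/2\<rceil>, 1, \<lceil>n/2\<rceil> + 1, \<dots>\<close>. Along this list a window contains
  every second vertex, up to a defect, so an interval of the list is balanced; for even \<open>n\<close> an
  interval of even length must in addition consist of antipodal pairs, which is achieved by
  placing the even classes first. Therefore a coloring is a weak maximizer only if \<open>W\<close> of the
  coloring is the sum of the bounds of its classes, and the theorem becomes a question about
  minimizing \<open>\<Sum>c. \<phi> (s c)\<close> over positive integers \<open>s c\<close> with sum \<open>n\<close>, where \<open>\<phi> m\<close> is eight
  times the bound for classes of size \<open>m\<close> (\<open>minimal_weak_maximizer_iff\<close>).

  This minimum is found from a line that lies below \<open>\<phi>\<close> and meets it at the quotient \<open>q = n div k\<close>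
  and at \<open>q + 1\<close>: sums of the line are constant, so the minimizers are the size vectors all of whose
  entries are points of contact. For odd \<open>n\<close> the only points of contact are \<open>q\<close> and \<open>q + 1\<close>, and the
  minimizers are the equitable size vectors. For even \<open>n\<close>, \<open>\<phi> m\<close> is \<open>n m\<^sup>2\<close>, reduced by
  \<open>n\<close> when \<open>m\<close> is odd; it is linear on every triple \<open>2 a - 1, 2 a, 2 a + 1\<close>, and the points of
  contact form the triple that contains \<open>q\<close> and \<open>q + 1\<close>. Replacing two entries
  \<open>2 a\<close> by \<open>2 a - 1\<close> and \<open>2 a + 1\<close> moves among the types with entries in that triple, and the reverse
  replacement leads from every one of them to the equitable tuple, so they form the closure of that
  tuple under unit shifts (\<open>equitable_tuple_shift_closure_iff\<close>).
\<close>

section \<open>Distances in the cycle\<close>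

lemma cycle_arc:
  assumes n: "2 \<le> n" and u: "u < n" and s: "s = 1 \<or> s = n - 1"
  shows "(u, (u + s) mod n) \<in> arcs (cycle_graph n)"
proof -
  have ne: "u \<noteq> (u + s) mod n"
  proof (cases "u + s < n")
    case True
    then show ?thesis using s n by auto
  next
    case False
    then have "n \<le> u + s" "u + s - n < n" using s n u by auto
    then have "(u + s) mod n = u + s - n" by (simp add: le_mod_geq)
    then show ?thesis using s n u False by auto
  qed
  have "int ((u + s) mod n) = int (u + s) mod int n"
    by (simp add: zmod_int)
  then have "[int u - int ((u + s) mod n) = int u - int (u + s)] (mod int n)"
    by (simp add: cong_def mod_diff_right_eq)
  moreover have "int u - int (u + s) = - int s" by simp
  ultimately have c: "[int u - int ((u + s) mod n) = - int s] (mod int n)"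
    by simp
  have "[int u - int ((u + s) mod n) = 1] (mod int n) \<or> [int u - int ((u + s) mod n) = -1] (mod int n)"
    using s
  proof
    assume "s = 1"
    then show ?thesis using c by simp
  next
    assume s: "s = n - 1"
    have "[- int s = 1] (mod int n)"
      unfolding s cong_iff_dvd_diff using n by (simp add: of_nat_diff)
    then show ?thesis using c cong_trans by blast
  qed
  then show ?thesis using ne u n by (simp add: cycle_graph_def)
qed

text \<open>
  The step \<open>n - 1\<close> is a backward step modulo \<open>n\<close>; both directions are needed, because the shorter
  arc between two vertices may be either one.
\<close>
lemma cycle_walk_exists:
  assumes n: "2 \<le> n" and u: "u < n" and s: "s = 1 \<or> s = n - 1"
  shows "\<exists>p. pre_digraph.awalk (cycle_graph n) u p ((u + l * s) mod n) \<and> length p = l"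
  using u
proof (induction l arbitrary: u)
  case 0
  then show ?case
    by (auto simp: pre_digraph.awalk_def pre_digraph.cas.simps cycle_graph_def)
next
  case (Suc l)
  let ?w = "(u + s) mod n"
  have "?w < n" using n by simp
  from Suc.IH[OF this] obtain p
    where p: "pre_digraph.awalk (cycle_graph n) ?w p ((?w + l * s) mod n)" "length p = l" by blast
  have e: "(?w + l * s) mod n = (u + Suc l * s) mod n"
    by (simp add: mod_add_left_eq add.assoc)
  have "pre_digraph.awalk (cycle_graph n) u ((u, ?w) # p) ((u + Suc l * s) mod n)"
    using p(1) cycle_arc[OF n Suc.prems s] Suc.prems unfolding e
    by (auto simp: pre_digraph.awalk_def pre_digraph.cas.simps cycle_graph_def)
  then show ?case using p(2) by (intro exI[of _ "(u, ?w) # p"]) simp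
qed

text \<open>
  A walk lifts to the integers, where every arc changes the position by one. This yields the lower
  bound for distances.
\<close>
lemma cycle_walk_displacement:
  assumes "pre_digraph.awalk (cycle_graph n) u p v"
  shows "\<exists>z. \<bar>z\<bar> \<le> int (length p) \<and> [int v = int u + z] (mod int n)"
  using assms
proof (induction p arbitrary: u)
  case Nil
  then have "v = u" by (simp add: pre_digraph.awalk_def pre_digraph.cas.simps)
  then show ?case by (intro exI[of _ 0]) simp
next
  case (Cons e p)
  obtain x w where xw: "e = (x, w)" by (cases e)
  have arc: "(x, w) \<in> arcs (cycle_graph n)" and "x = u"
    and walk: "pre_digraph.awalk (cycle_graph n) w p v"
    using Cons.prems unfolding xw
    by (auto simp: pre_digraph.awalk_def pre_digraph.cas.simps cycle_graph_def)
  from Cons.IH[OF walk] obtain z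
    where z: "\<bar>z\<bar> \<le> int (length p)" "[int v = int w + z] (mod int n)" by blast
  have "[int u - int w = 1] (mod int n) \<or> [int u - int w = -1] (mod int n)"
    using arc \<open>x = u\<close> by (simp add: cycle_graph_def)
  then obtain d :: int where d: "\<bar>d\<bar> = 1" "[int u - int w = d] (mod int n)"
    by (metis abs_1 abs_minus_cancel)
  have "int n dvd (int v - (int w + z)) - ((int u - int w) - d)"
    using z(2) d(2) unfolding cong_iff_dvd_diff by (rule dvd_diff)
  moreover have "(int v - (int w + z)) - ((int u - int w) - d) = int v - (int u + (z - d))" by simp
  ultimately have "[int v = int u + (z - d)] (mod int n)"
    unfolding cong_iff_dvd_diff by simp
  moreover have "\<bar>z - d\<bar> \<le> int (length (e # p))" using z(1) d(1) by simp
  ultimately show ?case by blast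
qed

lemma gdist_cycle:
  assumes n: "2 \<le> n" and uv: "u < v" "v < n"
  shows "gdist (cycle_graph n) u v = min (v - u) (n - (v - u))"
  unfolding gdist_def
proof (rule Least_equality)
  have "(u + (v - u) * 1) mod n = v" using uv by simp
  then have "\<exists>p. pre_digraph.awalk (cycle_graph n) u p v \<and> length p = v - u"
    using cycle_walk_exists[OF n, of u 1 "v - u"] uv by simp
  moreover have "(u + (n - (v - u)) * (n - 1)) mod n = v"
  proof -
    have "int (u + (n - (v - u)) * (n - 1)) = int v + int n * (int n - 1 + int u - int v)"
    proof -
      have "int (n - (v - u)) = int n - int v + int u" "int (n - 1) = int n - 1" using uv by auto
      then show ?thesis unfolding of_nat_add of_nat_mult by (simp add: algebra_simps)
    qed
    then have "int (u + (n - (v - u)) * (n - 1)) mod int n = int v mod int n"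
      by (metis mod_mult_self2)
    then show ?thesis using uv by (metis mod_less of_nat_eq_iff zmod_int)
  qed
  then have "\<exists>p. pre_digraph.awalk (cycle_graph n) u p v \<and> length p = n - (v - u)"
    using cycle_walk_exists[OF n, of u "n - 1" "n - (v - u)"] uv by simp
  ultimately show "\<exists>p. pre_digraph.awalk (cycle_graph n) u p v \<and> length p = min (v - u) (n - (v - u))"
    by (metis (full_types) min_def)
next
  fix l
  assume "\<exists>p. pre_digraph.awalk (cycle_graph n) u p v \<and> length p = l"
  then obtain z where z: "\<bar>z\<bar> \<le> int l" "[int v = int u + z] (mod int n)"
    using cycle_walk_displacement by blast
  then have "int n dvd int v - int u - z"
    by (simp add: cong_iff_dvd_diff diff_diff_eq)
  then obtain t where t: "int v - int u - z = int n * t" by (elim dvdE)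
  show "min (v - u) (n - (v - u)) \<le> l"
  proof (cases "t \<le> 0")
    case True
    then have "int n * t \<le> 0" by (simp add: mult_nonneg_nonpos)
    then show ?thesis using z(1) t uv by linarith
  next
    case False
    then have "int n * t \<ge> int n * 1" by (intro mult_left_mono) auto
    then show ?thesis using z(1) t uv by linarith
  qed
qed

section \<open>The Wiener index through imbalances of windows\<close>

text \<open>
  The \<open>n div 2\<close> cyclically consecutive vertices that begin at \<open>i\<close>. For \<open>u, i < n\<close> the conditional is
  \<open>(u - i) mod n\<close>, written without the modulus so that linear arithmetic applies.
\<close>
definition window :: "nat \<Rightarrow> nat \<Rightarrow> nat set" where
  "window n i = {u. (if i \<le> u then u - i else u + n - i) < n div 2}"

lemma bij_betw_reflection:
  assumes "u < n"
  shows "bij_betw (\<lambda>i. if i \<le> u then u - i else u + n - i) {0..<n} {0..<n::nat}"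
  using assms by (intro bij_betw_byWitness[where f' = "\<lambda>i. if i \<le> u then u - i else u + n - i"]) auto

lemma card_windows_containing:
  assumes "u < n"
  shows "card {i \<in> {0..<n}. u \<in> window n i} = n div 2"
proof -
  let ?r = "\<lambda>i. if i \<le> u then u - i else u + n - i"
  have "bij_betw ?r {i \<in> {0..<n}. ?r i < n div 2} {w \<in> {0..<n}. w < n div 2}"
    using bij_betw_reflection[OF assms]
    by (rule bij_betw_Collect) auto
  moreover have "{w \<in> {0..<n}. w < n div 2} = {0..<n div 2}" by auto
  ultimately show ?thesis
    by (simp add: window_def bij_betw_same_card)
qed

text \<open>
  A window is determined by the position of \<open>u\<close> relative to its beginning, and \<open>v\<close> is \<open>v - u\<close> steps
  further. So the count is the size of the symmetric difference of an arc of length \<open>n div 2\<close> and its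
  rotation by \<open>v - u\<close>.
\<close>
lemma card_windows_separating:
  assumes uv: "u < v" "v < n"
  shows "card {i \<in> {0..<n}. (u \<in> window n i) \<noteq> (v \<in> window n i)} = 2 * min (v - u) (n - (v - u))"
proof -
  let ?r = "\<lambda>i. if i \<le> u then u - i else u + n - i"
  define h where "h = n div 2"
  define d where "d = v - u"
  have h: "2 * h \<le> n" "n \<le> 2 * h + 1" unfolding h_def by auto
  have d: "0 < d" "d < n" using uv by (auto simp: d_def)
  let ?S = "{w \<in> {0..<n}. (w < h) \<noteq> ((if w + d < n then w + d else w + d - n) < h)}"
  have "bij_betw ?r {i \<in> {0..<n}. (u \<in> window n i) \<noteq> (v \<in> window n i)} ?S"
    using bij_betw_reflection[of u n] uv
  proof (intro bij_betw_Collect)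
    fix i assume i: "i \<in> {0..<n}"
    have "u \<in> window n i \<longleftrightarrow> ?r i < h" by (simp add: window_def h_def)
    moreover have "v \<in> window n i \<longleftrightarrow> (if ?r i + d < n then ?r i + d else ?r i + d - n) < h"
      using uv i by (auto simp: window_def h_def d_def)
    ultimately show "((?r i < h) \<noteq> ((if ?r i + d < n then ?r i + d else ?r i + d - n) < h)) =
       ((u \<in> window n i) \<noteq> (v \<in> window n i))" by simp
  qed simp
  then have "card {i \<in> {0..<n}. (u \<in> window n i) \<noteq> (v \<in> window n i)} = card ?S"
    by (rule bij_betw_same_card)
  also have "card ?S = 2 * min d (n - d)"
  proof (cases "d \<le> h")
    case True
    then have "?S = {h - d..<h} \<union> {n - d..<n}" using h d by auto
    moreover have "card ({h - d..<h} \<union> {n - d..<n}) = card {h - d..<h} + card {n - d..<n}"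
      using True h by (intro card_Un_disjoint) auto
    ultimately show ?thesis using True h d by simp
  next
    case False
    then have "?S = {0..<n - d} \<union> {h..<h + (n - d)}" using h d by auto
    moreover have "card ({0..<n - d} \<union> {h..<h + (n - d)}) = card {0..<n - d} + card {h..<h + (n - d)}"
      using False h by (intro card_Un_disjoint) auto
    ultimately show ?thesis using False h d by simp
  qed
  finally show ?thesis by (simp add: d_def)
qed

text \<open>
  Each separated pair has one member in \<open>H\<close>; listing that member first loses the order \<open>u < v\<close> but
  gives an element of a product.
\<close>
lemma card_separated_pairs:
  fixes A :: "'a::linorder set"
  assumes "finite A"
  shows "card {(u, v). u \<in> A \<and> v \<in> A \<and> u < v \<and> (u \<in> H) \<noteq> (v \<in> H)} = card (A \<inter> H) * card (A - H)"
proof -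
  have "bij_betw (\<lambda>(u, v). if u \<in> H then (u, v) else (v, u))
      {(u, v). u \<in> A \<and> v \<in> A \<and> u < v \<and> (u \<in> H) \<noteq> (v \<in> H)} ((A \<inter> H) \<times> (A - H))"
    by (rule bij_betw_byWitness[where f' = "\<lambda>(u, v). if u < v then (u, v) else (v, u)"])
      (auto split: if_splits simp: not_less order.order_iff_strict)
  then show ?thesis by (simp add: bij_betw_same_card card_cartesian_product)
qed

lemma wiener_cycle_windows:
  assumes n: "2 \<le> n" and A: "A \<subseteq> {0..<n}"
  shows "2 * wiener (cycle_graph n) A = (\<Sum>i\<in>{0..<n}. card (A \<inter> window n i) * card (A - window n i))"
proof -
  have fin: "finite A" using A finite_subset by blast
  define P where "P = {(u, v). u \<in> A \<and> v \<in> A \<and> u < v}"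
  have finP: "finite P" unfolding P_def by (rule finite_subset[of _ "A \<times> A"]) (auto simp: fin)
  have "2 * wiener (cycle_graph n) A = (\<Sum>(u, v)\<in>P. 2 * gdist (cycle_graph n) u v)"
    by (simp add: wiener_def P_def sum_distrib_left case_prod_beta)
  also have "\<dots> = (\<Sum>(u, v)\<in>P. \<Sum>i\<in>{0..<n}. of_bool ((u \<in> window n i) \<noteq> (v \<in> window n i)))"
  proof (intro sum.cong refl, clarify)
    fix u v assume "(u, v) \<in> P"
    then have uv: "u < v" "v < n" using A by (auto simp: P_def)
    have "{0..<n} \<inter> {i. (u \<in> window n i) \<noteq> (v \<in> window n i)} = {i \<in> {0..<n}. (u \<in> window n i) \<noteq> (v \<in> window n i)}"
      by blast
    then show "2 * gdist (cycle_graph n) u v = (\<Sum>i\<in>{0..<n}. of_bool ((u \<in> window n i) \<noteq> (v \<in> window n i)))"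
      using gdist_cycle[OF n uv] card_windows_separating[OF uv] by simp
  qed
  also have "\<dots> = (\<Sum>i\<in>{0..<n}. \<Sum>(u, v)\<in>P. of_bool ((u \<in> window n i) \<noteq> (v \<in> window n i)))"
    unfolding case_prod_beta by (rule sum.swap)
  also have "\<dots> = (\<Sum>i\<in>{0..<n}. card (A \<inter> window n i) * card (A - window n i))"
  proof (intro sum.cong refl)
    fix i
    have "(\<Sum>(u, v)\<in>P. of_bool ((u \<in> window n i) \<noteq> (v \<in> window n i)))
        = card (P \<inter> {x. (fst x \<in> window n i) \<noteq> (snd x \<in> window n i)})"
      unfolding case_prod_beta using finP by simp
    also have "P \<inter> {x. (fst x \<in> window n i) \<noteq> (snd x \<in> window n i)}
        = {(u, v). u \<in> A \<and> v \<in> A \<and> u < v \<and> (u \<in> window n i) \<noteq> (v \<in> window n i)}"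
      by (auto simp: P_def)
    finally show "(\<Sum>(u, v)\<in>P. of_bool ((u \<in> window n i) \<noteq> (v \<in> window n i)))
        = card (A \<inter> window n i) * card (A - window n i)"
      using card_separated_pairs[OF fin] by simp
  qed
  finally show ?thesis .
qed

text \<open>
  The number of vertices of \<open>A\<close> inside the window minus the number outside.
\<close>
definition imbalance :: "nat \<Rightarrow> nat set \<Rightarrow> nat \<Rightarrow> int" where
  "imbalance n A i = 2 * int (card (A \<inter> window n i)) - int (card A)"

lemma wiener_cycle_imbalance:
  assumes n: "2 \<le> n" and A: "A \<subseteq> {0..<n}"
  shows "8 * int (wiener (cycle_graph n) A)
    = int n * (int (card A))\<^sup>2 - (\<Sum>i\<in>{0..<n}. (imbalance n A i)\<^sup>2)"
proof -
  have fin: "finite A" using A finite_subset by blast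
  have "4 * int (card (A \<inter> window n i) * card (A - window n i))
      = (int (card A))\<^sup>2 - (imbalance n A i)\<^sup>2" for i
  proof -
    have "card A = card (A \<inter> window n i) + card (A - window n i)"
      using fin by (metis card_Diff_subset_Int card_Int_Diff finite_Int)
    then show ?thesis
      unfolding imbalance_def power2_eq_square by (simp add: algebra_simps)
  qed
  note w = this
  have "8 * int (wiener (cycle_graph n) A) = 4 * int (2 * wiener (cycle_graph n) A)" by simp
  also have "\<dots> = (\<Sum>i\<in>{0..<n}. 4 * int (card (A \<inter> window n i) * card (A - window n i)))"
    unfolding wiener_cycle_windows[OF n A] by (simp only: of_nat_sum sum_distrib_left)
  also have "\<dots> = (\<Sum>i\<in>{0..<n}. (int (card A))\<^sup>2 - (imbalance n A i)\<^sup>2)"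
    by (simp only: w)
  finally show ?thesis by (simp add: sum_subtractf)
qed

section \<open>The upper bound for sets of given size\<close>

text \<open>
  Eight times the largest Wiener index of a set of \<open>m\<close> vertices of the cycle. The subtracted term is
  the least possible sum of the squared imbalances.
\<close>
definition max_wiener8 :: "nat \<Rightarrow> nat \<Rightarrow> int" where
  "max_wiener8 n m = int n * (int m)\<^sup>2 - (if odd m then int n else if odd n then 2 * int m else 0)"

lemma bij_betw_rotation:
  "bij_betw (\<lambda>i. (i + r) mod n) {0..<n} {0..<n::nat}"
proof -
  have inj: "inj_on (\<lambda>i. (i + r) mod n) {0..<n}"
  proof (rule inj_onI)
    fix i j assume ij: "i \<in> {0..<n}" "j \<in> {0..<n}" "(i + r) mod n = (j + r) mod n"
    then have "[i + r = j + r] (mod n)" by (simp add: cong_def)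
    then have "[i = j] (mod n)" by (simp add: cong_add_rcancel_nat)
    then show "i = j" using ij by (simp add: cong_def)
  qed
  moreover have "(\<lambda>i. (i + r) mod n) ` {0..<n} = {0..<n}"
    using inj by (intro endo_inj_surj) auto
  ultimately show ?thesis by (simp add: bij_betw_def)
qed

lemma mem_window_iff:
  assumes "u < n" "i < n"
  shows "u \<in> window n i \<longleftrightarrow> (i \<le> u \<and> u < i + n div 2) \<or> u + n < i + n div 2"
  using assms by (auto simp: window_def)

text \<open>
  On an odd cycle, removing \<open>v\<close> leaves a path of \<open>2 (n div 2)\<close> vertices, whose two halves are windows.
\<close>
lemma card_windows_around_vertex:
  assumes n: "odd n" and A: "A \<subseteq> {0..<n}" and v: "v < n"
  shows "card (A \<inter> window n ((v + 1) mod n)) + card (A \<inter> window n ((v + (1 + n div 2)) mod n))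
    = card (A - {v})"
proof -
  define h where "h = n div 2"
  have nh: "n = 2 * h + 1" using n unfolding h_def by presburger
  have fin: "finite A" using A finite_subset by blast
  define i j where "i = (v + 1) mod n" and "j = (v + (1 + h)) mod n"
  have i: "i = (if v + 1 < n then v + 1 else 0)"
    and j: "j = (if v + 1 + h < n then v + 1 + h else v + 1 + h - n)"
  proof -
    have "v + 1 = n" if "\<not> v + 1 < n" using that v by simp
    then show "i = (if v + 1 < n then v + 1 else 0)" by (auto simp: i_def)
    have "n \<le> v + 1 + h \<and> v + 1 + h - n < n" if "\<not> v + 1 + h < n" using that v nh by auto
    then show "j = (if v + 1 + h < n then v + 1 + h else v + 1 + h - n)"
      by (auto simp: j_def le_mod_geq)
  qed
  have cover: "(u \<in> window n i \<or> u \<in> window n j \<longleftrightarrow> u \<noteq> v) \<and> \<not> (u \<in> window n i \<and> u \<in> window n j)"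
    if "u < n" for u
  proof -
    have "i < n" "j < n" using v nh by (auto simp: i j)
    then have "u \<in> window n i \<longleftrightarrow> (i \<le> u \<and> u < i + h) \<or> u + n < i + h"
      "u \<in> window n j \<longleftrightarrow> (j \<le> u \<and> u < j + h) \<or> u + n < j + h"
      using that by (simp_all add: mem_window_iff h_def)
    moreover consider "v + 1 + h < n" | "v + 1 < n" "n \<le> v + 1 + h" | "v + 1 = n" using v by linarith
    then have "(((i \<le> u \<and> u < i + h) \<or> u + n < i + h) \<or> ((j \<le> u \<and> u < j + h) \<or> u + n < j + h) \<longleftrightarrow> u \<noteq> v)
      \<and> \<not> (((i \<le> u \<and> u < i + h) \<or> u + n < i + h) \<and> ((j \<le> u \<and> u < j + h) \<or> u + n < j + h))"
    proof cases
      case 1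
      then have "i = v + 1" "j = v + 1 + h" by (simp_all add: i j)
      then show ?thesis using 1 that nh by auto
    next
      case 2
      then have "i = v + 1" "j + n = v + 1 + h" by (simp_all add: i j)
      then show ?thesis using 2 that nh by auto
    next
      case 3
      then have "i = 0" "j = h" using nh by (simp_all add: i j)
      then show ?thesis using 3 that nh by auto
    qed
    ultimately show ?thesis by simp
  qed
  have lt: "u < n" if "u \<in> A" for u using that A by auto
  have "A - {v} = (A \<inter> window n i) \<union> (A \<inter> window n j)"
    using cover[OF lt] by (intro set_eqI) (metis Diff_iff Int_iff Un_iff singleton_iff)
  moreover have "(A \<inter> window n i) \<inter> (A \<inter> window n j) = {}"
    using cover[OF lt] by (metis Int_iff disjoint_iff)
  ultimately have "card (A - {v}) = card (A \<inter> window n i) + card (A \<inter> window n j)"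
    using fin by (simp add: card_Un_disjoint)
  then show ?thesis by (simp only: i_def j_def h_def)
qed

text \<open>
  For \<open>v \<in> A\<close> the two windows that miss only \<open>v\<close> have even imbalances with sum \<open>-2\<close>, so their
  squares add up to at least \<open>4\<close>. Summing over \<open>v \<in> A\<close> meets every window at most twice.
\<close>
lemma sum_imbalance_squares_odd_cycle:
  assumes n: "odd n" and A: "A \<subseteq> {0..<n}" and m: "even (card A)"
  shows "2 * int (card A) \<le> (\<Sum>i\<in>{0..<n}. (imbalance n A i)\<^sup>2)"
proof -
  have fin: "finite A" using A finite_subset by blast
  let ?c = "\<lambda>i. (imbalance n A i)\<^sup>2"
  let ?d = "\<lambda>v. ?c ((v + 1) mod n) + ?c ((v + (1 + n div 2)) mod n)"
  have rot: "(\<Sum>v\<in>{0..<n}. ?c ((v + r) mod n)) = (\<Sum>i\<in>{0..<n}. ?c i)" for r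
    by (rule sum.reindex_bij_betw[OF bij_betw_rotation])
  have "4 \<le> ?d v" if "v \<in> A" for v
  proof -
    let ?x = "imbalance n A ((v + 1) mod n)" and ?y = "imbalance n A ((v + (1 + n div 2)) mod n)"
    have "card (A - {v}) = card A - 1" "0 < card A"
      using that fin by (auto simp: card_gt_0_iff)
    then have "?x + ?y = - 2"
      using card_windows_around_vertex[OF n A, of v] that A unfolding imbalance_def by auto
    moreover have "even ?x" "even ?y" using m by (auto simp: imbalance_def)
    ultimately obtain z where z: "?x = 2 * z" "?y = - 2 - 2 * z"
    proof -
      obtain z where "?x = 2 * z" using \<open>even ?x\<close> by (elim evenE)
      then show thesis using that \<open>?x + ?y = - 2\<close> by (simp add: algebra_simps)
    qed
    \<comment> \<open>The sum of the two squares is \<open>4 + 8 z (z + 1)\<close>, and \<open>z\<close> is an integer.\<close>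
    have "0 \<le> z * (z + 1)" by (cases "0 \<le> z") (auto simp: mult_nonpos_nonpos)
    then show ?thesis unfolding z by (simp add: power2_eq_square algebra_simps)
  qed
  then have "4 * int (card A) \<le> (\<Sum>v\<in>A. ?d v)"
    using sum_bounded_below[of A "4::int" ?d] by simp
  also have "\<dots> \<le> (\<Sum>v\<in>{0..<n}. ?d v)"
    using A by (intro sum_mono2) auto
  also have "\<dots> = 2 * (\<Sum>i\<in>{0..<n}. ?c i)"
    by (simp only: sum.distrib rot)
  finally show ?thesis by simp
qed

lemma wiener_cycle_le:
  assumes n: "2 \<le> n" and A: "A \<subseteq> {0..<n}"
  shows "8 * int (wiener (cycle_graph n) A) \<le> max_wiener8 n (card A)"
proof -
  have "(if odd (card A) then int n else if odd n then 2 * int (card A) else 0)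
      \<le> (\<Sum>i\<in>{0..<n}. (imbalance n A i)\<^sup>2)"
  proof (cases "odd (card A)")
    case True
    have "1 \<le> (imbalance n A i)\<^sup>2" for i
    proof -
      have "imbalance n A i \<noteq> 0" using True unfolding imbalance_def by presburger
      then show ?thesis by (simp add: int_one_le_iff_zero_less)
    qed
    then show ?thesis using True sum_bounded_below[of "{0..<n}" "1::int" "\<lambda>i. (imbalance n A i)\<^sup>2"] by simp
  next
    case False
    then show ?thesis using sum_imbalance_squares_odd_cycle[OF _ A] by (simp add: sum_nonneg)
  qed
  then show ?thesis unfolding max_wiener8_def wiener_cycle_imbalance[OF n A] by simp
qed

section \<open>Intervals of the interleaved order attain the bound\<close>

text \<open>
  The list of vertices \<open>0, \<lceil>n/2\<rceil>, 1, \<lceil>n/2\<rceil> + 1, \<dots>\<close>, in which consecutive vertices are opposite or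
  almost opposite.
\<close>
definition interleave :: "nat \<Rightarrow> nat \<Rightarrow> nat" where
  "interleave n q = (if even q then 0 else (n + 1) div 2) + q div 2"

lemma bij_betw_interleave: "bij_betw (interleave n) {0..<n} {0..<n}"
proof -
  define c where "c = (n + 1) div 2"
  have c: "n \<le> 2 * c" by (simp add: c_def)
  have inj: "inj_on (interleave n) {0..<n}"
  proof (rule inj_onI)
    fix p q assume "p \<in> {0..<n}" "q \<in> {0..<n}" "interleave n p = interleave n q"
    then have pq: "p < n" "q < n"
      "(if even p then 0 else c) + p div 2 = (if even q then 0 else c) + q div 2"
      by (auto simp: interleave_def c_def)
    define a b where "a = p div 2" and "b = q div 2"
    have "even p \<and> p = 2 * a \<or> odd p \<and> p = 2 * a + 1" "even q \<and> q = 2 * b \<or> odd q \<and> q = 2 * b + 1"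
      unfolding a_def b_def by presburger+
    then show "p = q" using pq c unfolding a_def[symmetric] b_def[symmetric] by auto
  qed
  moreover have "interleave n ` {0..<n} = {0..<n}"
  proof (rule endo_inj_surj)
    show "interleave n ` {0..<n} \<subseteq> {0..<n}"
      by (auto simp: interleave_def elim!: oddE evenE)
  qed (use inj in auto)
  ultimately show ?thesis by (simp add: bij_betw_def)
qed

text \<open>
  A closed form for the number of \<open>q' < q\<close> such that \<open>interleave n q'\<close> lies in \<open>window n i\<close>.
  The window contains every second vertex of the list, apart from a defect. For even
  \<open>n\<close> it contains one vertex of every antipodal pair at positions \<open>2 r\<close>, \<open>2 r + 1\<close>, and which of the
  two changes at most once. For odd \<open>n\<close> there is one place, in the cyclic sense, where two consecutive vertices
  of the list are both outside. The window at \<open>0\<close> follows the formula for a window at \<open>n\<close>.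
\<close>
definition interleave_prefix :: "nat \<Rightarrow> nat \<Rightarrow> nat \<Rightarrow> nat" where
  "interleave_prefix n i q =
    (if even n then
       if i \<le> n div 2 then (if q < 2 * i then q div 2 else (q + 1) div 2)
       else (if q + n < 2 * i then (q + 1) div 2 else q div 2)
     else
       if 0 < i \<and> i \<le> n div 2 + 1 then (if q + 1 < 2 * i then q div 2 else (q - 1) div 2)
       else let i = (if i = 0 then n else i) in
         (if q + n < 2 * i then (q + 1) div 2 else q div 2))"

lemma interleave_prefix_Suc:
  assumes q: "q < n" and i: "i < n"
  shows "interleave_prefix n i (Suc q) = interleave_prefix n i q + of_bool (interleave n q \<in> window n i)"
proof -
  define h where "h = n div 2"
  define r where "r = q div 2"
  have "interleave n q < n"
    using bij_betw_interleave q by (fastforce simp: bij_betw_def)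
  note mem = mem_window_iff[OF this i]
  have "q = 2 * r \<or> q = 2 * r + 1" "n = 2 * h \<or> n = 2 * h + 1"
    unfolding r_def h_def by presburger+
  then consider "q = 2 * r" "n = 2 * h" | "q = 2 * r + 1" "n = 2 * h"
    | "q = 2 * r" "n = 2 * h + 1" | "q = 2 * r + 1" "n = 2 * h + 1" by blast
  then show ?thesis
  proof cases
    case 1
    then have "interleave n q = r" by (simp add: interleave_def)
    then have m: "interleave n q \<in> window n i \<longleftrightarrow> (i \<le> r \<and> r < i + h) \<or> r + n < i + h"
      using mem by (simp add: h_def)
    show ?thesis using 1 q i unfolding m
      by (cases "i \<le> h") (auto simp: interleave_prefix_def)
  next
    case 2
    then have "interleave n q = h + r" by (simp add: interleave_def)
    then have m: "interleave n q \<in> window n i \<longleftrightarrow> (i \<le> h + r \<and> h + r < i + h) \<or> h + r + n < i + h"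
      using mem by (simp add: h_def)
    show ?thesis using 2 q i unfolding m
      by (cases "i \<le> h") (auto simp: interleave_prefix_def)
  next
    case 3
    then have "interleave n q = r" by (simp add: interleave_def)
    then have m: "interleave n q \<in> window n i \<longleftrightarrow> (i \<le> r \<and> r < i + h) \<or> r + n < i + h"
      using mem by (simp add: h_def)
    show ?thesis using 3 q i unfolding m
      by (cases "i = 0"; cases "i \<le> h + 1") (auto simp: interleave_prefix_def)
  next
    case 4
    then have "interleave n q = h + 1 + r" by (simp add: interleave_def)
    then have m: "interleave n q \<in> window n i \<longleftrightarrow> (i \<le> h + 1 + r \<and> h + 1 + r < i + h) \<or> h + 1 + r + n < i + h"
      using mem by (simp add: h_def)
    show ?thesis using 4 q i unfolding m
      by (cases "i = 0"; cases "i \<le> h + 1") (auto simp: interleave_prefix_def, presburger)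
  qed
qed

lemma inj_on_interleave_interval:
  assumes "p + m \<le> n"
  shows "inj_on (interleave n) {p..<p + m}"
  using bij_betw_imp_inj_on[OF bij_betw_interleave] by (rule inj_on_subset) (use assms in auto)

lemma card_interleave_window:
  assumes i: "i < n" and "p + m \<le> n"
  shows "interleave_prefix n i p + card (interleave n ` {p..<p + m} \<inter> window n i)
    = interleave_prefix n i (p + m)"
  using assms(2)
proof (induction m)
  case 0
  then show ?case by simp
next
  case (Suc m)
  have inj: "inj_on (interleave n) {p..<p + Suc m}"
    by (rule inj_on_interleave_interval[OF Suc.prems])
  have "interleave n (p + m) \<notin> interleave n ` {p..<p + m}"
    using inj_onD[OF inj, of "p + m"] by force
  moreover have "{p..<p + Suc m} = insert (p + m) {p..<p + m}" by auto
  ultimately have "card (interleave n ` {p..<p + Suc m} \<inter> window n i)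
      = card (interleave n ` {p..<p + m} \<inter> window n i) + of_bool (interleave n (p + m) \<in> window n i)"
    by simp
  then show ?case
    using Suc interleave_prefix_Suc[of "p + m" n i] i by simp
qed

text \<open>
  The window picks every second vertex of the interval, hence half of them up to rounding. On an odd
  cycle an even interval loses one more vertex, giving \<open>-2\<close>, when the defect of the window coincides
  with one of the consecutive pairs into which the interval is divided.
\<close>
lemma imbalance_interleave_interval:
  assumes i: "i < n" and pm: "p + m \<le> n"
  defines "c \<equiv> imbalance n (interleave n ` {p..<p + m}) i"
  shows "odd m \<Longrightarrow> c\<^sup>2 = 1"
    and "even m \<Longrightarrow> even n \<Longrightarrow> even p \<Longrightarrow> c = 0"
    and "even m \<Longrightarrow> odd n \<Longrightarrow> c = 0 \<or> c = - 2"
proof -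
  have card: "card (interleave n ` {p..<p + m}) = m"
    using inj_on_interleave_interval[OF pm] by (simp add: card_image)
  have c: "c = 2 * (int (interleave_prefix n i (p + m)) - int (interleave_prefix n i p)) - int m"
    unfolding c_def imbalance_def card card_interleave_window[OF i pm, symmetric] of_nat_add by simp
  let ?x = "interleave_prefix n i p" and ?y = "interleave_prefix n i (p + m)"
  \<comment> \<open>Rounding of \<open>p / 2\<close> and \<open>(p + m) / 2\<close>, according to the position of the defect.\<close>
  have even_n: "?x = p div 2 \<and> ?y = (p + m) div 2 \<or> ?x = p div 2 \<and> ?y = (p + m + 1) div 2
      \<or> ?x = (p + 1) div 2 \<and> ?y = (p + m + 1) div 2 \<or> ?x = (p + 1) div 2 \<and> ?y = (p + m) div 2"
    if "even n"
  proof (cases "i \<le> n div 2")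
    case True
    then show ?thesis using that
      by (cases "p < 2 * i"; cases "p + m < 2 * i") (simp_all add: interleave_prefix_def)
  next
    case False
    then show ?thesis using that
      by (cases "p + n < 2 * i"; cases "p + m + n < 2 * i") (simp_all add: interleave_prefix_def)
  qed
  have odd_n: "?x = p div 2 \<and> ?y = (p + m) div 2 \<or> 0 < p + m \<and> ?x = p div 2 \<and> ?y = (p + m - 1) div 2
      \<or> 0 < p \<and> ?x = (p - 1) div 2 \<and> ?y = (p + m - 1) div 2
      \<or> ?x = (p + 1) div 2 \<and> ?y = (p + m + 1) div 2 \<or> ?x = (p + 1) div 2 \<and> ?y = (p + m) div 2"
    if "odd n"
  proof (cases "0 < i \<and> i \<le> n div 2 + 1")
    case True
    then show ?thesis using that
      by (cases "p + 1 < 2 * i"; cases "p + m + 1 < 2 * i") (simp_all add: interleave_prefix_def)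
  next
    case False
    define j where "j = (if i = 0 then n else i)"
    have "interleave_prefix n i q = (if q + n < 2 * j then (q + 1) div 2 else q div 2)" for q
      using False that by (auto simp: interleave_prefix_def j_def)
    then show ?thesis
      by (cases "p + n < 2 * j"; cases "p + m + n < 2 * j") simp_all
  qed
  define r where "r = p div 2"
  have r: "p = 2 * r \<or> p = 2 * r + 1" unfolding r_def by presburger
  show "c\<^sup>2 = 1" if "odd m"
  proof -
    obtain s where s: "m = 2 * s + 1" using \<open>odd m\<close> by (elim oddE)
    have "?y = ?x + s + 1 \<or> ?y = ?x + s"
    proof (cases "even n")
      case True
      show ?thesis using r
      proof
        assume "p = 2 * r"
        then show ?thesis using even_n[OF True] by (simp add: s) linarith
      next
        assume "p = 2 * r + 1"
        then show ?thesis using even_n[OF True] by (simp add: s) linarith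
      qed
    next
      case False
      show ?thesis using r
      proof
        assume "p = 2 * r"
        then show ?thesis using odd_n[OF False] by (simp add: s) linarith
      next
        assume "p = 2 * r + 1"
        then show ?thesis using odd_n[OF False] by (simp add: s) linarith
      qed
    qed
    then have "c = 1 \<or> c = - 1" unfolding c s by auto
    then show ?thesis by auto
  qed
  show "c = 0" if "even m" and n: "even n" and p: "even p"
  proof -
    obtain s where s: "m = 2 * s" using \<open>even m\<close> by (elim evenE)
    have "p = 2 * r" using r p by auto
    then have "?y = ?x + s" using even_n[OF n] by (simp add: s)
    then show ?thesis unfolding c s by auto
  qed
  show "c = 0 \<or> c = - 2" if "even m" and n: "odd n"
  proof -
    obtain s where s: "m = 2 * s" using \<open>even m\<close> by (elim evenE)
    have "?y = ?x + s \<or> ?y + 1 = ?x + s" using r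
    proof
      assume "p = 2 * r"
      then show ?thesis using odd_n[OF n] by (simp add: s) linarith
    next
      assume "p = 2 * r + 1"
      then show ?thesis using odd_n[OF n] by (simp add: s) linarith
    qed
    then show ?thesis unfolding c s by auto
  qed
qed

text \<open>
  Every vertex lies in \<open>n div 2\<close> windows. When imbalances are restricted to \<open>0\<close> and \<open>-2\<close>, their squares
  are \<open>-2\<close> times their values, so this sum determines the sum of squares.
\<close>
lemma sum_imbalance:
  assumes A: "A \<subseteq> {0..<n}" and n: "odd n"
  shows "(\<Sum>i\<in>{0..<n}. imbalance n A i) = - int (card A)"
proof -
  have fin: "finite A" using A finite_subset by blast
  have "(\<Sum>i\<in>{0..<n}. card (A \<inter> window n i)) = (\<Sum>i\<in>{0..<n}. \<Sum>u\<in>A. of_bool (u \<in> window n i))"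
    using fin by (simp add: Int_def)
  also have "\<dots> = (\<Sum>u\<in>A. \<Sum>i\<in>{0..<n}. of_bool (u \<in> window n i))"
    by (rule sum.swap)
  also have "\<dots> = (\<Sum>u\<in>A. n div 2)"
  proof (intro sum.cong refl)
    fix u assume "u \<in> A"
    then have "u < n" using A by auto
    moreover have "{0..<n} \<inter> {i. u \<in> window n i} = {i \<in> {0..<n}. u \<in> window n i}" by blast
    ultimately show "(\<Sum>i\<in>{0..<n}. of_bool (u \<in> window n i)) = n div 2"
      using card_windows_containing by simp
  qed
  finally have "(\<Sum>i\<in>{0..<n}. card (A \<inter> window n i)) = card A * (n div 2)" by simp
  then have s: "(\<Sum>i\<in>{0..<n}. int (card (A \<inter> window n i))) = int (card A) * int (n div 2)"
    by (metis of_nat_mult of_nat_sum)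
  have "int n = 2 * int (n div 2) + 1" using n by presburger
  then show ?thesis
    by (simp add: imbalance_def sum_subtractf s algebra_simps flip: sum_distrib_left)
qed

text \<open>
  The side condition excludes only the even intervals of an even cycle that cut through antipodal
  pairs; there the imbalance can be different from \<open>0\<close>.
\<close>
lemma wiener_interleave_interval:
  assumes n: "2 \<le> n" and pm: "p + m \<le> n" and par: "odd n \<or> odd m \<or> even p"
  shows "8 * int (wiener (cycle_graph n) (interleave n ` {p..<p + m})) = max_wiener8 n m"
proof -
  let ?A = "interleave n ` {p..<p + m}"
  have A: "?A \<subseteq> {0..<n}"
    using bij_betw_imp_surj_on[OF bij_betw_interleave, of n] pm by fastforce
  have card: "card ?A = m"
    using inj_on_interleave_interval[OF pm] by (simp add: card_image)
  note imb = imbalance_interleave_interval[OF _ pm]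
  have "(\<Sum>i\<in>{0..<n}. (imbalance n ?A i)\<^sup>2) = (if odd m then int n else if odd n then 2 * int m else 0)"
  proof (cases "odd m")
    case True
    then show ?thesis using imb(1) by simp
  next
    case m: False
    show ?thesis
    proof (cases "odd n")
      case True
      have "(\<Sum>i\<in>{0..<n}. (imbalance n ?A i)\<^sup>2) = (\<Sum>i\<in>{0..<n}. - 2 * imbalance n ?A i)"
        using imb(3) m True by (intro sum.cong) (fastforce simp: power2_eq_square)+
      also have "\<dots> = - 2 * (\<Sum>i\<in>{0..<n}. imbalance n ?A i)" by (rule sum_distrib_left[symmetric])
      finally show ?thesis using m True sum_imbalance[OF A True] card by simp
    next
      case False
      then show ?thesis using imb(2) m par by simp
    qed
  qed
  then show ?thesis unfolding wiener_cycle_imbalance[OF n A] card max_wiener8_def by simp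
qed

section \<open>Colorings with optimal classes\<close>

lemma verts_cycle_graph: "verts (cycle_graph n) = {0..<n}"
  by (simp add: cycle_graph_def)

lemma positions_of_run:
  fixes s :: "'a \<Rightarrow> nat"
  defines "runs \<equiv> \<lambda>cs. concat (map (\<lambda>d. replicate (s d) d) cs)"
  assumes "c \<notin> set xs" "c \<notin> set ys"
  shows "{q \<in> {0..<length (runs (xs @ c # ys))}. runs (xs @ c # ys) ! q = c}
    = {length (runs xs)..<length (runs xs) + s c}"
proof -
  have r: "runs (xs @ c # ys) = runs xs @ replicate (s c) c @ runs ys" by (simp add: runs_def)
  have x: "c \<notin> set (runs xs)" "c \<notin> set (runs ys)" using assms(2,3) by (auto simp: runs_def)
  let ?p = "length (runs xs)"
  have "runs (xs @ c # ys) ! q = c \<longleftrightarrow> ?p \<le> q \<and> q < ?p + s c"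
    if q: "q < length (runs (xs @ c # ys))" for q
  proof -
    consider "q < ?p" | "?p \<le> q" "q < ?p + s c" | "?p + s c \<le> q" by linarith
    then show ?thesis
    proof cases
      case 1
      then have "runs xs ! q \<noteq> c" using x(1) nth_mem by metis
      then show ?thesis using 1 by (simp add: r nth_append)
    next
      case 2
      then have "q - ?p < s c" by linarith
      then show ?thesis using 2 by (simp add: r nth_append)
    next
      case 3
      then have "q - ?p - s c < length (runs ys)" using q by (simp add: r)
      then have "runs ys ! (q - ?p - s c) \<noteq> c" using x(2) nth_mem by metis
      then show ?thesis using 3 by (simp add: r nth_append)
    qed
  qed
  moreover have "?p + s c \<le> length (runs (xs @ c # ys))" by (simp add: r)
  ultimately show ?thesis by auto
qed

text \<open>
  The colors occupy consecutive intervals of the interleaved list. Colors with even sizes come first,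
  so that their intervals begin at even positions; odd intervals may begin anywhere.
\<close>
lemma optimal_coloring_with_class_sizes:
  assumes n: "2 \<le> n" and pos: "\<And>c. c \<in> {1..k} \<Longrightarrow> 0 < s c" and sum: "(\<Sum>c\<in>{1..k}. s c) = n"
  shows "\<exists>f\<in>surj_colorings (cycle_graph n) k. \<forall>c\<in>{1..k}.
    card (color_class (cycle_graph n) f c) = s c \<and>
    8 * int (wiener (cycle_graph n) (color_class (cycle_graph n) f c)) = max_wiener8 n (s c)"
proof -
  let ?key = "\<lambda>c. s c mod 2"
  define runs where "runs cs = concat (map (\<lambda>d. replicate (s d) d) cs)" for cs :: "nat list"
  \<comment> \<open>Even sizes have the smaller key.\<close>
  define cs where "cs = sort_key ?key [1..<Suc k]"
  have set: "set cs = {1..k}" and dist: "distinct cs" and sorted: "sorted (map ?key cs)"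
    by (auto simp: cs_def)
  have "length (runs cs) = sum_list (map s cs)"
    by (simp add: runs_def length_concat comp_def)
  also have "\<dots> = n" using dist set sum by (simp add: sum_list_distinct_conv_sum_set)
  finally have len: "length (runs cs) = n" .
  define f where "f = restrict (\<lambda>v. runs cs ! inv_into {0..<n} (interleave n) v) {0..<n}"
  have inj: "inj_on (interleave n) {0..<n}" and img: "interleave n ` {0..<n} = {0..<n}"
    using bij_betw_interleave[of n] by (auto simp: bij_betw_def)
  have f: "f (interleave n q) = runs cs ! q" if "q \<in> {0..<n}" for q
    using that inj img by (auto simp: f_def)
  have cls: "color_class (cycle_graph n) f c = interleave n ` {q \<in> {0..<n}. runs cs ! q = c}" for c
  proof -
    have "color_class (cycle_graph n) f c = {v \<in> interleave n ` {0..<n}. f v = c}"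
      by (simp add: color_class_def verts_cycle_graph img)
    also have "\<dots> = interleave n ` {q \<in> {0..<n}. runs cs ! q = c}" using f by auto
    finally show ?thesis .
  qed
  have main: "card (color_class (cycle_graph n) f c) = s c \<and>
      8 * int (wiener (cycle_graph n) (color_class (cycle_graph n) f c)) = max_wiener8 n (s c)"
    if c: "c \<in> {1..k}" for c
  proof -
    obtain xs ys where xy: "cs = xs @ c # ys" using c set split_list by metis
    define p where "p = length (runs xs)"
    have "{q \<in> {0..<n}. runs cs ! q = c} = {p..<p + s c}"
      using positions_of_run[of c xs ys s] dist len unfolding xy p_def runs_def by auto
    then have cl: "color_class (cycle_graph n) f c = interleave n ` {p..<p + s c}" using cls by simp
    have pn: "p + s c \<le> n"
      using len by (simp add: xy p_def runs_def)
    have "odd (s c) \<or> even p"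
    proof (cases "odd (s c)")
      case False
      then have "even (s d)" if "d \<in> set xs" for d
        using sorted that unfolding xy by (fastforce simp: sorted_append)
      then have "even (sum_list (map s xs))" by (induction xs) auto
      then show ?thesis by (simp add: p_def runs_def length_concat comp_def)
    qed simp
    then have "8 * int (wiener (cycle_graph n) (color_class (cycle_graph n) f c)) = max_wiener8 n (s c)"
      unfolding cl by (intro wiener_interleave_interval n pn) blast
    then show ?thesis
      using inj_on_interleave_interval[OF pn] unfolding cl by (simp add: card_image)
  qed
  have "f v \<in> {1..k}" if v: "v \<in> {0..<n}" for v
  proof -
    obtain q where "q \<in> {0..<n}" "v = interleave n q" using v img by blast
    then have "f v \<in> set (runs cs)" using f len by simp
    then show ?thesis by (auto simp: runs_def set)
  qed
  moreover have "c \<in> f ` {0..<n}" if "c \<in> {1..k}" for c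
  proof -
    have "color_class (cycle_graph n) f c \<noteq> {}" using main[OF that] pos[OF that] by force
    then show ?thesis by (auto simp: color_class_def verts_cycle_graph)
  qed
  ultimately have "f \<in> surj_colorings (cycle_graph n) k"
    by (auto simp: surj_colorings_def colorings_def verts_cycle_graph f_def PiE_def extensional_def)
  then show ?thesis using main by blast
qed

section \<open>Weak maximizers and class sizes\<close>

text \<open>
  The vectors of class sizes that surjective colorings of \<open>C\<^sub>n\<close> with \<open>k\<close> colors can have.
\<close>
definition class_sizes :: "nat \<Rightarrow> nat \<Rightarrow> (nat \<Rightarrow> nat) \<Rightarrow> bool" where
  "class_sizes n k s \<longleftrightarrow> (\<forall>c\<in>{1..k}. 0 < s c) \<and> (\<Sum>c\<in>{1..k}. s c) = n"

lemma class_sizes_surj_coloring: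
  assumes "f \<in> surj_colorings (cycle_graph n) k"
  shows "class_sizes n k (\<lambda>c. card (color_class (cycle_graph n) f c))"
  unfolding class_sizes_def
proof (intro conjI ballI)
  let ?C = "color_class (cycle_graph n) f"
  have img: "f ` {0..<n} = {1..k}"
    using assms by (simp add: surj_colorings_def verts_cycle_graph)
  have C: "?C c = {v \<in> {0..<n}. f v = c}" for c by (simp add: color_class_def verts_cycle_graph)
  show "0 < card (?C c)" if "c \<in> {1..k}" for c
  proof -
    obtain v where "v \<in> {0..<n}" "f v = c" using \<open>c \<in> {1..k}\<close> img by (metis imageE)
    then have "?C c \<noteq> {}" using C by blast
    then show ?thesis by (simp add: C card_gt_0_iff)
  qed
  have "(\<Union>c\<in>{1..k}. ?C c) = {0..<n}" using img C by blast
  moreover have "card (\<Union>c\<in>{1..k}. ?C c) = (\<Sum>c\<in>{1..k}. card (?C c))"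
    by (intro card_UN_disjoint) (auto simp: C)
  ultimately show "(\<Sum>c\<in>{1..k}. card (?C c)) = n" by simp
qed

lemma length_color_type [simp]: "length (color_type G k f) = k"
  by (simp add: color_type_def)

lemma sorted_color_type [simp]: "sorted (color_type G k f)"
  by (simp add: color_type_def)

lemma set_color_type: "set (color_type G k f) = (\<lambda>c. int (card (color_class G f c))) ` {1..k}"
  by (auto simp: color_type_def)

lemma sum_list_color_type:
  "sum_list (map g (color_type G k f)) = (\<Sum>c\<in>{1..k}. g (int (card (color_class G f c))))"
proof -
  have "sum_list (map g (sort xs)) = sum_list (map g xs)" for xs :: "int list"
    by (metis mset_map mset_sort sum_mset_sum_list)
  then show ?thesis
    by (simp add: color_type_def comp_def interv_sum_list_conv_sum_set_nat atLeastLessThanSuc_atLeastAtMost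
        del: upt_Suc)
qed

lemma color_wiener_cycle_le:
  assumes "2 \<le> n"
  shows "8 * int (color_wiener (cycle_graph n) k f)
    \<le> (\<Sum>c\<in>{1..k}. max_wiener8 n (card (color_class (cycle_graph n) f c)))"
proof -
  have "(\<Sum>c\<in>{1..k}. 8 * int (wiener (cycle_graph n) (color_class (cycle_graph n) f c)))
    \<le> (\<Sum>c\<in>{1..k}. max_wiener8 n (card (color_class (cycle_graph n) f c)))"
    using assms by (intro sum_mono wiener_cycle_le) (auto simp: color_class_def verts_cycle_graph)
  then show ?thesis by (simp add: color_wiener_def sum_distrib_left)
qed

lemma weak_maximizer_with_class_sizes:
  assumes n: "2 \<le> n" and s: "class_sizes n k s"
  obtains f where "f \<in> weak_maximizers (cycle_graph n) k"
    and "\<And>c. c \<in> {1..k} \<Longrightarrow> card (color_class (cycle_graph n) f c) = s c"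
    and "8 * int (color_wiener (cycle_graph n) k f) = (\<Sum>c\<in>{1..k}. max_wiener8 n (s c))"
proof -
  let ?G = "cycle_graph n"
  obtain f where f: "f \<in> surj_colorings ?G k"
    and c: "\<And>c. c \<in> {1..k} \<Longrightarrow> card (color_class ?G f c) = s c"
    and w: "\<And>c. c \<in> {1..k} \<Longrightarrow> 8 * int (wiener ?G (color_class ?G f c)) = max_wiener8 n (s c)"
    using optimal_coloring_with_class_sizes[OF n, of k s] s unfolding class_sizes_def by blast
  have W: "8 * int (color_wiener ?G k f) = (\<Sum>c\<in>{1..k}. max_wiener8 n (s c))"
    using w by (simp add: color_wiener_def sum_distrib_left)
  have "color_wiener ?G k f' \<le> color_wiener ?G k f" if t: "color_type ?G k f' = color_type ?G k f" for f'
  proof -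
    have "(\<Sum>c\<in>{1..k}. max_wiener8 n (card (color_class ?G f' c)))
        = (\<Sum>c\<in>{1..k}. max_wiener8 n (card (color_class ?G f c)))"
      using sum_list_color_type[of "\<lambda>x. max_wiener8 n (nat x)" ?G k] t by (metis (no_types, lifting) nat_int sum.cong)
    also have "\<dots> = (\<Sum>c\<in>{1..k}. max_wiener8 n (s c))" using c by simp
    finally show ?thesis using color_wiener_cycle_le[OF n, of k f'] W by simp
  qed
  then have "f \<in> weak_maximizers ?G k" using f by (simp add: weak_maximizers_def)
  then show thesis using that c W by blast
qed

text \<open>
  A coloring with the same class sizes in which every class attains its bound has the same type, so a
  weak maximizer cannot have a smaller value.
\<close>
lemma color_wiener_weak_maximizer:
  assumes n: "2 \<le> n" and f: "f \<in> weak_maximizers (cycle_graph n) k"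
  shows "8 * int (color_wiener (cycle_graph n) k f)
    = (\<Sum>c\<in>{1..k}. max_wiener8 n (card (color_class (cycle_graph n) f c)))"
proof -
  let ?G = "cycle_graph n"
  have fs: "f \<in> surj_colorings ?G k" using f by (simp add: weak_maximizers_def)
  obtain f' where f': "f' \<in> weak_maximizers ?G k"
    and c: "\<And>c. c \<in> {1..k} \<Longrightarrow> card (color_class ?G f' c) = card (color_class ?G f c)"
    and w: "8 * int (color_wiener ?G k f') = (\<Sum>c\<in>{1..k}. max_wiener8 n (card (color_class ?G f c)))"
    using weak_maximizer_with_class_sizes[OF n class_sizes_surj_coloring[OF fs]] by blast
  have "map (\<lambda>i. int (card (color_class ?G f' i))) [1..<Suc k] = map (\<lambda>i. int (card (color_class ?G f i))) [1..<Suc k]"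
    using c by (simp del: upt_Suc)
  then have "color_type ?G k f' = color_type ?G k f" unfolding color_type_def by (rule arg_cong)
  then have "color_wiener ?G k f' \<le> color_wiener ?G k f"
    using f f' by (simp add: weak_maximizers_def)
  then show ?thesis using w color_wiener_cycle_le[OF n, of k f] by simp
qed

lemma finite_weak_maximizers: "finite (weak_maximizers (cycle_graph n) k)"
  by (rule finite_subset[of _ "colorings (cycle_graph n) k"])
    (auto simp: weak_maximizers_def surj_colorings_def colorings_def verts_cycle_graph intro: finite_PiE)

lemma minimal_weak_maximizer_iff:
  assumes n: "2 \<le> n" and f: "f \<in> weak_maximizers (cycle_graph n) k"
  shows "color_wiener (cycle_graph n) k f
      = Min (color_wiener (cycle_graph n) k ` weak_maximizers (cycle_graph n) k) \<longleftrightarrow>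
    (\<forall>s. class_sizes n k s \<longrightarrow>
      (\<Sum>c\<in>{1..k}. max_wiener8 n (card (color_class (cycle_graph n) f c))) \<le> (\<Sum>c\<in>{1..k}. max_wiener8 n (s c)))"
    (is "?L \<longleftrightarrow> ?R")
proof -
  let ?G = "cycle_graph n"
  have fin: "finite (color_wiener ?G k ` weak_maximizers ?G k)" using finite_weak_maximizers by simp
  have "?L \<longleftrightarrow> (\<forall>f'\<in>weak_maximizers ?G k. color_wiener ?G k f \<le> color_wiener ?G k f')"
    using f fin by (subst eq_Min_iff) auto
  also have "\<dots> \<longleftrightarrow> ?R"
  proof (intro iffI allI impI ballI)
    fix s assume "\<forall>f'\<in>weak_maximizers ?G k. color_wiener ?G k f \<le> color_wiener ?G k f'"
      and s: "class_sizes n k s"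
    moreover obtain f' where "f' \<in> weak_maximizers ?G k"
      "8 * int (color_wiener ?G k f') = (\<Sum>c\<in>{1..k}. max_wiener8 n (s c))"
      using weak_maximizer_with_class_sizes[OF n s] by blast
    ultimately show "(\<Sum>c\<in>{1..k}. max_wiener8 n (card (color_class ?G f c))) \<le> (\<Sum>c\<in>{1..k}. max_wiener8 n (s c))"
      using color_wiener_weak_maximizer[OF n f] by fastforce
  next
    fix f' assume R: ?R and f': "f' \<in> weak_maximizers ?G k"
    have "class_sizes n k (\<lambda>c. card (color_class ?G f' c))"
      using f' by (intro class_sizes_surj_coloring) (simp add: weak_maximizers_def)
    then show "color_wiener ?G k f \<le> color_wiener ?G k f'"
      using R color_wiener_weak_maximizer[OF n f] color_wiener_weak_maximizer[OF n f'] by fastforce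
  qed
  finally show ?thesis .
qed

section \<open>Minimizing over the class sizes\<close>

text \<open>
  The linear function \<open>\<alpha> + \<beta> y\<close> has the same sum \<open>k \<alpha> + \<beta> n\<close> over every size vector. Comparing sums of
  \<open>\<phi>\<close> is thus comparing sums of the nonnegative excess of \<open>\<phi>\<close> over that function, and \<open>s0\<close> has
  excess \<open>0\<close>.
\<close>
lemma minimal_sum_iff_on_tangent:
  fixes \<phi> :: "nat \<Rightarrow> int"
  assumes above: "\<And>y. \<alpha> + \<beta> * int y \<le> \<phi> y" and touch: "\<And>y. \<phi> y = \<alpha> + \<beta> * int y \<longleftrightarrow> Q y"
    and s0: "class_sizes n k s0" "\<And>c. c \<in> {1..k} \<Longrightarrow> Q (s0 c)" and s: "class_sizes n k s"
  shows "(\<forall>s'. class_sizes n k s' \<longrightarrow> (\<Sum>c\<in>{1..k}. \<phi> (s c)) \<le> (\<Sum>c\<in>{1..k}. \<phi> (s' c))) \<longleftrightarrow>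
    (\<forall>c\<in>{1..k}. Q (s c))"
proof -
  define e where "e s' = (\<Sum>c\<in>{1..k}. \<phi> (s' c) - (\<alpha> + \<beta> * int (s' c)))" for s'
  have excess: "(\<Sum>c\<in>{1..k}. \<phi> (s' c)) = int k * \<alpha> + \<beta> * int n + e s'" if "class_sizes n k s'" for s'
  proof -
    have "(\<Sum>c\<in>{1..k}. int (s' c)) = int n"
      using that by (simp add: class_sizes_def flip: of_nat_sum)
    then show ?thesis by (simp add: e_def sum.distrib sum_subtractf flip: sum_distrib_left)
  qed
  have nonneg: "0 \<le> e s'" for s'
    unfolding e_def using above by (intro sum_nonneg) (simp add: algebra_simps)
  have zero: "e s' = 0 \<longleftrightarrow> (\<forall>c\<in>{1..k}. Q (s' c))" for s'
    unfolding e_def using above touch by (subst sum_nonneg_eq_0_iff) (auto simp: algebra_simps)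
  have e0: "e s0 = 0" using zero s0 by blast
  have "(\<Sum>c\<in>{1..k}. \<phi> (s c)) \<le> (\<Sum>c\<in>{1..k}. \<phi> (s' c)) \<longleftrightarrow> e s \<le> e s'" if "class_sizes n k s'" for s'
    using excess[OF s] excess[OF that] by linarith
  then have "(\<forall>s'. class_sizes n k s' \<longrightarrow> (\<Sum>c\<in>{1..k}. \<phi> (s c)) \<le> (\<Sum>c\<in>{1..k}. \<phi> (s' c))) \<longleftrightarrow>
      (\<forall>s'. class_sizes n k s' \<longrightarrow> e s \<le> e s')"
    by (intro iff_allI imp_cong refl)
  also have "\<dots> \<longleftrightarrow> e s = 0"
  proof
    assume "\<forall>s'. class_sizes n k s' \<longrightarrow> e s \<le> e s'"
    then have "e s \<le> e s0" using s0(1) by blast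
    then show "e s = 0" using e0 nonneg[of s] by linarith
  qed (simp add: nonneg)
  finally show ?thesis using zero by simp
qed

text \<open>
  With \<open>x = y - 2 a\<close> the difference of the two sides is \<open>n\<close> times \<open>x\<^sup>2\<close> minus the parity of \<open>x\<close>.
\<close>
lemma max_wiener8_tangent_even:
  assumes n: "even n" "0 < n"
  shows "- (4 * int n * a\<^sup>2) + 4 * int n * a * int y \<le> max_wiener8 n y"
    and "max_wiener8 n y = - (4 * int n * a\<^sup>2) + 4 * int n * a * int y \<longleftrightarrow> \<bar>int y - 2 * a\<bar> \<le> 1"
proof -
  define x where "x = int y - 2 * a"
  have odd: "odd y \<longleftrightarrow> odd x" by (simp add: x_def)
  have y: "int y = x + 2 * a" by (simp add: x_def)
  define D where "D = x\<^sup>2 - of_bool (odd x)"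
  have diff: "max_wiener8 n y - (- (4 * int n * a\<^sup>2) + 4 * int n * a * int y) = int n * D"
    unfolding max_wiener8_def odd y D_def using n by (simp add: power2_eq_square algebra_simps)
  have "0 \<le> D \<and> (D = 0 \<longleftrightarrow> \<bar>x\<bar> \<le> 1)"
  proof (cases "\<bar>x\<bar> \<le> 1")
    case True
    then have "x = -1 \<or> x = 0 \<or> x = 1" by linarith
    then show ?thesis by (auto simp: D_def)
  next
    case False
    then have "2 * 2 \<le> \<bar>x\<bar> * \<bar>x\<bar>" by (intro mult_mono) auto
    then have "3 \<le> D" by (simp add: D_def power2_eq_square)
    then show ?thesis using False by simp
  qed
  then have "0 \<le> int n * D" "int n * D = 0 \<longleftrightarrow> \<bar>x\<bar> \<le> 1" using n by simp_all
  then show "- (4 * int n * a\<^sup>2) + 4 * int n * a * int y \<le> max_wiener8 n y"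
    and "max_wiener8 n y = - (4 * int n * a\<^sup>2) + 4 * int n * a * int y \<longleftrightarrow> \<bar>int y - 2 * a\<bar> \<le> 1"
    using diff unfolding x_def[symmetric] by linarith+
qed

text \<open>
  The line through the points of \<open>\<phi>\<close> at \<open>q\<close> and \<open>q + 1\<close>. In each of the four parity classes of
  \<open>(q, y)\<close> the excess factors as \<open>4 z (n z + r)\<close> with \<open>|r| < n\<close>, where \<open>z\<close> is half the distance of
  \<open>y\<close> from the one of \<open>q\<close>, \<open>q + 1\<close> that has the same parity; such a product is positive unless
  \<open>z = 0\<close>.
\<close>
lemma max_wiener8_tangent_odd:
  assumes n: "odd n" and q: "1 \<le> q" "q + 1 < n"
  defines "\<beta> \<equiv> max_wiener8 n (q + 1) - max_wiener8 n q"
  shows "max_wiener8 n q - \<beta> * int q + \<beta> * int y \<le> max_wiener8 n y"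
    and "max_wiener8 n y = max_wiener8 n q - \<beta> * int q + \<beta> * int y \<longleftrightarrow> y = q \<or> y = q + 1"
proof -
  define E where "E = max_wiener8 n y - (max_wiener8 n q - \<beta> * int q + \<beta> * int y)"
  have "\<exists>z r. E = 4 * (z * (int n * z + r)) \<and> \<bar>r\<bar> < int n \<and> (z = 0 \<longleftrightarrow> y = q \<or> y = q + 1)"
  proof (cases "even (int y - int q)")
    case True
    then obtain z where "int y - int q = 2 * z" by (elim evenE)
    then have y: "int y = int q + 2 * z" by simp
    have par: "odd y \<longleftrightarrow> odd q" using True by simp
    have z: "z = 0 \<longleftrightarrow> y = q \<or> y = q + 1" using y by presburger
    show ?thesis
    proof (cases "even q")
      case True
      then have "E = 4 * (z * (int n * z + (- 1 - int q)))"
        using n par unfolding E_def \<beta>_def max_wiener8_def y by (simp add: power2_eq_square algebra_simps)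
      then show ?thesis using z q by (intro exI[of _ z] exI[of _ "- 1 - int q"]) auto
    next
      case False
      then have "E = 4 * (z * (int n * z + (int q + 1 - int n)))"
        using n par unfolding E_def \<beta>_def max_wiener8_def y by (simp add: power2_eq_square algebra_simps)
      then show ?thesis using z q by (intro exI[of _ z] exI[of _ "int q + 1 - int n"]) auto
    qed
  next
    case False
    then obtain z where "int y - int q = 2 * z + 1" by (elim oddE)
    then have y: "int y = int q + 2 * z + 1" by simp
    have par: "odd y \<longleftrightarrow> even q" using False by simp
    have z: "z = 0 \<longleftrightarrow> y = q \<or> y = q + 1" using y by presburger
    show ?thesis
    proof (cases "even q")
      case True
      then have "E = 4 * (z * (int n * z + (int n - int q)))"
        using n par unfolding E_def \<beta>_def max_wiener8_def y by (simp add: power2_eq_square algebra_simps)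
      then show ?thesis using z q by (intro exI[of _ z] exI[of _ "int n - int q"]) auto
    next
      case False
      then have "E = 4 * (z * (int n * z + int q))"
        using n par unfolding E_def \<beta>_def max_wiener8_def y by (simp add: power2_eq_square algebra_simps)
      then show ?thesis using z q by (intro exI[of _ z] exI[of _ "int q"]) auto
    qed
  qed
  then obtain z r where E: "E = 4 * (z * (int n * z + r))" and r: "\<bar>r\<bar> < int n"
    and z: "z = 0 \<longleftrightarrow> y = q \<or> y = q + 1" by blast
  have "0 < z * (int n * z + r)" if "z \<noteq> 0"
  proof (cases "0 < z")
    case True
    then have "int n * 1 \<le> int n * z" by (intro mult_left_mono) auto
    then show ?thesis using True r by simp
  next
    case False
    then have "int n * z \<le> int n * (- 1)" using that by (intro mult_left_mono) auto
    then show ?thesis using False that r by (simp add: zero_less_mult_iff)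
  qed
  then have "0 \<le> E" "E = 0 \<longleftrightarrow> y = q \<or> y = q + 1"
    using z unfolding E by (auto simp: less_imp_le) (metis less_irrefl mult_zero_left)+
  then show "max_wiener8 n q - \<beta> * int q + \<beta> * int y \<le> max_wiener8 n y"
    and "max_wiener8 n y = max_wiener8 n q - \<beta> * int q + \<beta> * int y \<longleftrightarrow> y = q \<or> y = q + 1"
    unfolding E_def by auto
qed

section \<open>Equitable tuples and unit shifts\<close>

lemma equitable_class_sizes_exist:
  assumes k: "0 < k" "k \<le> n"
  obtains s where "class_sizes n k s" and "\<And>c. s c = n div k \<or> s c = n div k + 1"
proof -
  define s where "s c = n div k + of_bool (c \<le> n mod k)" for c
  have "n div k > 0" using k by (simp add: div_greater_zero_iff)
  moreover have "(\<Sum>c\<in>{1..k}. s c) = n"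
  proof -
    have "n mod k < k" using k by simp
    then have "{1..k} \<inter> {c. c \<le> n mod k} = {1..n mod k}" by auto
    then show ?thesis by (simp add: s_def sum.distrib)
  qed
  ultimately show thesis using that[of s] by (simp add: class_sizes_def s_def)
qed

text \<open>
  If \<open>b\<close> is the least entry, the sum lies between \<open>k b\<close> and \<open>k (b + 1)\<close>, the upper bound being strict
  because \<open>b\<close> occurs. So \<open>b\<close> is the quotient.
\<close>
lemma equitable_entries:
  fixes xs :: "int list"
  assumes len: "length xs = k" "0 < k" and sum: "sum_list xs = int n"
    and diff: "\<And>x y. x \<in> set xs \<Longrightarrow> y \<in> set xs \<Longrightarrow> \<bar>x - y\<bar> \<le> 1" and x: "x \<in> set xs"
  shows "x = int (n div k) \<or> x = int (n div k) + 1"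
proof -
  define b where "b = Min (set xs)"
  have ne: "set xs \<noteq> {}" using len by auto
  have b: "b \<in> set xs" unfolding b_def using ne by (intro Min_in) auto
  have range: "b \<le> y \<and> y \<le> b + 1" if "y \<in> set xs" for y
  proof -
    have "b \<le> y" using that by (simp add: b_def)
    then show ?thesis using diff[OF that b] by linarith
  qed
  have "int k * b \<le> sum_list xs"
    using sum_list_mono[of xs "\<lambda>_. b" "\<lambda>y. y"] range len by (simp add: sum_list_triv)
  moreover have "sum_list xs < int k * (b + 1)"
  proof -
    obtain us vs where xs: "xs = us @ b # vs" using b split_list by metis
    have "sum_list us \<le> int (length us) * (b + 1)" "sum_list vs \<le> int (length vs) * (b + 1)"
      using sum_list_mono[of us "\<lambda>y. y" "\<lambda>_. b + 1"] sum_list_mono[of vs "\<lambda>y. y" "\<lambda>_. b + 1"] range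
      by (simp_all add: sum_list_triv xs)
    then show ?thesis using len by (auto simp: xs algebra_simps)
  qed
  ultimately have "int n div int k = b"
    using sum len by (intro int_div_pos_eq[where r = "int n - int k * b"]) (auto simp: algebra_simps)
  then have "b = int (n div k)" by (simp add: zdiv_int)
  then show ?thesis using range[OF x] by linarith
qed

lemma two_valued_sorted_eqI:
  fixes xs ys :: "int list"
  assumes "set xs \<subseteq> {q, q + 1}" "set ys \<subseteq> {q, q + 1}" "sorted xs" "sorted ys"
    and "length xs = length ys" "sum_list xs = sum_list ys"
  shows "xs = ys"
proof -
  have count: "sum_list zs = q * int (length zs) + int (count (mset zs) (q + 1))
      \<and> length zs = count (mset zs) q + count (mset zs) (q + 1)" if "set zs \<subseteq> {q, q + 1}" for zs
    using that by (induction zs) (auto simp: algebra_simps)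
  have "mset xs = mset ys"
  proof (rule multiset_eqI)
    fix x
    show "count (mset xs) x = count (mset ys) x"
    proof (cases "x \<in> {q, q + 1}")
      case True
      then show ?thesis using count[OF assms(1)] count[OF assms(2)] assms(5,6) by auto
    next
      case False
      then show ?thesis using assms(1,2) by (metis count_mset count_notin subsetD)
    qed
  qed
  then show ?thesis using assms(3,4) by (metis properties_for_sort)
qed

lemma equitable_tuple_eqI:
  assumes k: "0 < k" "k \<le> n" and xs: "length xs = k" "sorted xs" "sum_list xs = int n"
    and diff: "\<And>x y. x \<in> set xs \<Longrightarrow> y \<in> set xs \<Longrightarrow> \<bar>x - y\<bar> \<le> 1"
  shows "equitable_tuple n k = xs"
  unfolding equitable_tuple_def
proof (rule the_equality)
  have "0 < n div k" using k by (simp add: div_greater_zero_iff)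
  then have "0 < x" if "x \<in> set xs" for x
    using equitable_entries[OF xs(1) k(1) xs(3) diff that] by auto
  then show "length xs = k \<and> (\<forall>j<k. 0 < xs ! j) \<and> sum_list xs = int n \<and> sorted xs
      \<and> (\<forall>j<k. \<forall>j'<k. \<bar>xs ! j - xs ! j'\<bar> \<le> 1)"
    using xs diff by auto
next
  fix ys :: "int list"
  assume ys: "length ys = k \<and> (\<forall>j<k. 0 < ys ! j) \<and> sum_list ys = int n \<and> sorted ys
      \<and> (\<forall>j<k. \<forall>j'<k. \<bar>ys ! j - ys ! j'\<bar> \<le> 1)"
  then have "\<bar>x - y\<bar> \<le> 1" if "x \<in> set ys" "y \<in> set ys" for x y
    using that by (metis in_set_conv_nth)
  then have "set ys \<subseteq> {int (n div k), int (n div k) + 1}"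
    using equitable_entries[of ys k n] ys k by blast
  moreover have "set xs \<subseteq> {int (n div k), int (n div k) + 1}"
    using equitable_entries[of xs k n] xs diff k by blast
  ultimately show "ys = xs"
    using xs ys by (intro two_valued_sorted_eqI[where q = "int (n div k)"]) auto
qed

lemma shift_unit_same: "j < length x \<Longrightarrow> shift_unit j j x = sort x"
  by (simp add: shift_unit_def Let_def)

text \<open>
  The only even number within distance one of \<open>2 a\<close> is \<open>2 a\<close>, so a shift at two positions replaces
  two entries \<open>2 a\<close> by \<open>2 a - 1\<close> and \<open>2 a + 1\<close>; a shift within one position changes nothing.
\<close>
lemma shift_closure_within_one:
  assumes T: "\<And>t x. t \<in> T \<Longrightarrow> x \<in> set t \<Longrightarrow> \<bar>x - 2 * a\<bar> \<le> 1" and len: "\<And>t. t \<in> T \<Longrightarrow> length t = k"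
    and s: "s \<in> shift_closure k T" and x: "x \<in> set s"
  shows "\<bar>x - 2 * a\<bar> \<le> 1"
proof -
  have "length s = k \<and> (\<forall>x\<in>set s. \<bar>x - 2 * a\<bar> \<le> 1)" if "s \<in> (shift_step k ^^ l) T" for l s
    using that
  proof (induction l arbitrary: s)
    case 0
    then show ?case using T len by simp
  next
    case (Suc l)
    then have "s \<in> shift_step k ((shift_step k ^^ l) T)" by simp
    then consider "s \<in> (shift_step k ^^ l) T"
      | t j j' where "t \<in> (shift_step k ^^ l) T" "j \<le> j'" "j' < k" "even (t ! j)" "t ! j = t ! j'"
        "s = shift_unit j j' t"
      by (auto simp: shift_step_def)
    then show ?case
    proof cases
      case 1
      then show ?thesis by (rule Suc.IH)
    next
      case 2
      then have t: "length t = k" "\<And>x. x \<in> set t \<Longrightarrow> \<bar>x - 2 * a\<bar> \<le> 1" using Suc.IH by auto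
      show ?thesis
      proof (cases "j = j'")
        case True
        then show ?thesis using 2 t by (simp add: shift_unit_same)
      next
        case False
        have "\<bar>t ! j - 2 * a\<bar> \<le> 1" using t 2 by simp
        then have "t ! j = 2 * a" using 2(4) by presburger
        then have s: "s = sort (t[j := 2 * a - 1, j' := 2 * a + 1])"
          using 2 False by (simp add: shift_unit_def Let_def)
        have "set s \<subseteq> insert (2 * a + 1) (insert (2 * a - 1) (set t))"
          unfolding s set_sort by (meson insert_mono order_trans set_update_subset_insert)
        then show ?thesis using t s by auto
      qed
    qed
  qed
  then show ?thesis using s x by (auto simp: shift_closure_def)
qed

lemma shift_closure_step:
  assumes "t \<in> shift_closure k T" "length t = k"
    and "j \<le> j'" "j' < k" "even (t ! j)" "t ! j = t ! j'"
  shows "shift_unit j j' t \<in> shift_closure k T"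
proof -
  obtain l where "t \<in> (shift_step k ^^ l) T" using assms(1) by (auto simp: shift_closure_def)
  moreover have "shift_unit j j' t \<in> sorted_tuples k"
    using assms(2) by (simp add: sorted_tuples_def shift_unit_def Let_def)
  moreover have "shift_unit j j' t \<in> shift_step k S"
    if "t \<in> S" "shift_unit j j' t \<in> sorted_tuples k" for S
    unfolding shift_step_def mem_Collect_eq
    by (intro conjI disjI2 bexI[of _ t] exI[of _ j] exI[of _ j']) (use that assms(3-6) in auto)
  ultimately have "shift_unit j j' t \<in> shift_step k ((shift_step k ^^ l) T)" by blast
  then have "shift_unit j j' t \<in> (shift_step k ^^ Suc l) T" by simp
  moreover have "Suc l \<in> {1..}" by simp
  ultimately show ?thesis unfolding shift_closure_def by (intro UN_I)
qed

text \<open>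
  Induction on the number of entries \<open>2 a - 1\<close>. If \<open>2 a - 1\<close> or \<open>2 a + 1\<close> does not occur, the tuple is
  equitable. Otherwise it arises by one shift from the tuple in which one entry of each kind has been
  replaced by \<open>2 a\<close>.
\<close>
lemma within_one_in_shift_closure:
  assumes k: "0 < k" "k \<le> n"
    and xs: "length xs = k" "sorted xs" "sum_list xs = int n" "\<And>x. x \<in> set xs \<Longrightarrow> \<bar>x - 2 * a\<bar> \<le> 1"
  shows "xs \<in> shift_closure k {equitable_tuple n k}"
  using xs
proof (induction "count (mset xs) (2 * a - 1)" arbitrary: xs rule: less_induct)
  case less
  show ?case
  proof (cases "2 * a - 1 \<in> set xs \<and> 2 * a + 1 \<in> set xs")
    case False
    have range: "x = 2 * a - 1 \<or> x = 2 * a \<or> x = 2 * a + 1" if "x \<in> set xs" for x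
      using less.prems(4)[OF that] by linarith
    have "\<bar>x - y\<bar> \<le> 1" if "x \<in> set xs" "y \<in> set xs" for x y
      using range[OF that(1)] range[OF that(2)] False that by auto
    then have "equitable_tuple n k = xs" using k less.prems by (intro equitable_tuple_eqI) auto
    moreover have "xs \<in> sorted_tuples k" using less.prems by (simp add: sorted_tuples_def)
    ultimately have "xs \<in> (shift_step k ^^ 1) {equitable_tuple n k}"
      by (simp add: shift_step_def)
    then show ?thesis unfolding shift_closure_def by blast
  next
    case True
    define R where "R = mset xs - {#2 * a - 1#} - {#2 * a + 1#}"
    have "2 * a + 1 \<in># mset xs - {#2 * a - 1#}" using True by (simp add: in_diff_count)
    then have "add_mset (2 * a + 1) R = mset xs - {#2 * a - 1#}" unfolding R_def by (rule insert_DiffM)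
    moreover have "2 * a - 1 \<in># mset xs" using True by simp
    ultimately have R: "mset xs = add_mset (2 * a - 1) (add_mset (2 * a + 1) R)"
      by (simp only: insert_DiffM)
    define ys where "ys = sorted_list_of_multiset (add_mset (2 * a) (add_mset (2 * a) R))"
    have ys: "mset ys = add_mset (2 * a) (add_mset (2 * a) R)" "sorted ys"
      unfolding ys_def by (rule mset_sorted_list_of_multiset, rule sorted_sorted_list_of_multiset)
    have len: "length ys = k"
      using arg_cong[OF R, of size] arg_cong[OF ys(1), of size] less.prems(1) by simp
    have "sum_list ys = int n"
      using arg_cong[OF R, of sum_mset] arg_cong[OF ys(1), of sum_mset] less.prems(3)
      by (simp add: sum_mset_sum_list)
    moreover have "\<bar>x - 2 * a\<bar> \<le> 1" if "x \<in> set ys" for x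
    proof -
      have "x \<in># mset ys" using that by simp
      then have "x \<in># R \<or> x = 2 * a" unfolding ys(1) by auto
      moreover have "x \<in> set xs" if "x \<in># R"
      proof -
        have "x \<in># mset xs" using that unfolding R by simp
        then show ?thesis by simp
      qed
      ultimately show ?thesis using less.prems(4) by auto
    qed
    moreover have "count (mset ys) (2 * a - 1) < count (mset xs) (2 * a - 1)"
      unfolding R ys(1) by simp
    ultimately have clos: "ys \<in> shift_closure k {equitable_tuple n k}"
      using less.hyps ys(2) len by blast
    have "card {i. i < length ys \<and> ys ! i = 2 * a} = count (mset ys) (2 * a)"
      by (simp add: count_mset count_list_eq_length_filter length_filter_conv_card eq_commute)
    then have "\<not> card {i. i < length ys \<and> ys ! i = 2 * a} \<le> Suc 0" unfolding ys(1) by simp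
    then obtain i i' where "i < length ys" "ys ! i = 2 * a" "i' < length ys" "ys ! i' = 2 * a" "i \<noteq> i'"
      by (subst (asm) card_le_Suc0_iff_eq) auto
    then obtain j j' where j: "j < j'" "j' < k" "ys ! j = 2 * a" "ys ! j' = 2 * a"
      using len by (cases "i < i'") (auto simp: not_less_iff_gr_or_eq)
    have "mset (ys[j := 2 * a - 1, j' := 2 * a + 1]) = mset xs"
      using j len by (simp add: mset_update ys(1) R)
    then have "shift_unit j j' ys = xs"
      using j less.prems(2) by (simp add: shift_unit_def Let_def properties_for_sort)
    then show ?thesis using shift_closure_step[OF clos len, of j j'] j by simp
  qed
qed

text \<open>
  Of \<open>m\<close> and \<open>m + 1\<close> the even one is \<open>2 ((m + 1) div 2)\<close>.
\<close>
lemma within_one_of_even: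
  assumes "y = int m \<or> y = int m + 1"
  shows "\<bar>y - 2 * int ((m + 1) div 2)\<bar> \<le> 1"
  using assms by presburger

lemma equitable_tuple_shift_closure_iff:
  assumes k: "0 < k" "k \<le> n" and xs: "length xs = k" "sorted xs" "sum_list xs = int n"
  shows "xs \<in> shift_closure k {equitable_tuple n k} \<longleftrightarrow>
    (\<forall>x\<in>set xs. \<bar>x - 2 * int ((n div k + 1) div 2)\<bar> \<le> 1)"
proof
  let ?q = "n div k"
  obtain s where s: "class_sizes n k s" and q: "\<And>c. s c = ?q \<or> s c = ?q + 1"
    using equitable_class_sizes_exist[OF k] by blast
  define ys where "ys = sort (map (\<lambda>c. int (s c)) [1..<Suc k])"
  have entry: "int (s c) \<in> {int ?q, int ?q + 1}" for c using q[of c] by auto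
  have img: "set ys = (\<lambda>c. int (s c)) ` set [1..<Suc k]" unfolding ys_def by simp
  have "set ys \<subseteq> {int ?q, int ?q + 1}" unfolding img by (intro image_subsetI entry)
  moreover have "length ys = k" "sorted ys" by (simp_all add: ys_def del: upt_Suc)
  ultimately have ys: "length ys = k" "sorted ys" "set ys \<subseteq> {int ?q, int ?q + 1}" by blast+
  have "sum_list ys = sum_list (map (\<lambda>c. int (s c)) [1..<Suc k])"
    unfolding ys_def by (metis mset_sort sum_mset_sum_list)
  also have "\<dots> = int n"
    using s by (simp add: interv_sum_list_conv_sum_set_nat class_sizes_def atLeastLessThanSuc_atLeastAtMost
        del: upt_Suc flip: of_nat_sum)
  finally have total: "sum_list ys = int n" .
  have "\<bar>x - y\<bar> \<le> 1" if "x \<in> set ys" "y \<in> set ys" for x y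
    using subsetD[OF ys(3) that(1)] subsetD[OF ys(3) that(2)] by auto
  then have eq: "equitable_tuple n k = ys"
    by (intro equitable_tuple_eqI k ys(1,2) total)
  assume mem: "xs \<in> shift_closure k {equitable_tuple n k}"
  show "\<forall>x\<in>set xs. \<bar>x - 2 * int ((?q + 1) div 2)\<bar> \<le> 1"
  proof
    fix x assume "x \<in> set xs"
    then show "\<bar>x - 2 * int ((?q + 1) div 2)\<bar> \<le> 1"
    proof (rule shift_closure_within_one[rotated 3])
      show "xs \<in> shift_closure k {ys}" using mem eq by simp
      fix t y assume "t \<in> {ys}" "y \<in> set t"
      then have "y = int ?q \<or> y = int ?q + 1" using ys(3) by auto
      then show "\<bar>y - 2 * int ((?q + 1) div 2)\<bar> \<le> 1" by (rule within_one_of_even)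
    qed (simp add: ys)
  qed
next
  assume "\<forall>x\<in>set xs. \<bar>x - 2 * int ((n div k + 1) div 2)\<bar> \<le> 1"
  then show "xs \<in> shift_closure k {equitable_tuple n k}"
    using within_one_in_shift_closure[OF k xs] by blast
qed

section \<open>Minimal weak maximizers\<close>

theorem corollary4p11:
  fixes n k :: nat and f :: "nat \<Rightarrow> nat"
  assumes "2 \<le> k" and "k \<le> n"
    and "f \<in> weak_maximizers (cycle_graph n) k"
  shows "(even n \<longrightarrow>
        (color_wiener (cycle_graph n) k f
           = Min (color_wiener (cycle_graph n) k ` weak_maximizers (cycle_graph n) k)
         \<longleftrightarrow> color_type (cycle_graph n) k f \<in> shift_closure k {equitable_tuple n k}))
    \<and> (odd n \<longrightarrow>
        (color_wiener (cycle_graph n) k f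
           = Min (color_wiener (cycle_graph n) k ` weak_maximizers (cycle_graph n) k)
         \<longleftrightarrow> (\<forall>i\<in>{1..k}. \<forall>j\<in>{1..k}.
               \<bar>int (card (color_class (cycle_graph n) f i))
                - int (card (color_class (cycle_graph n) f j))\<bar> \<le> 1)))"
proof -
  let ?G = "cycle_graph n"
  let ?s = "\<lambda>c. card (color_class ?G f c)"
  define q where "q = n div k"
  have n: "2 \<le> n" and k: "0 < k" "k \<le> n" using assms by auto
  have s: "class_sizes n k ?s"
    using assms(3) by (intro class_sizes_surj_coloring) (simp add: weak_maximizers_def)
  have sum: "sum_list (color_type ?G k f) = int n"
    using sum_list_color_type[of "\<lambda>x. x" ?G k f] s by (simp add: class_sizes_def flip: of_nat_sum)
  obtain s0 where s0: "class_sizes n k s0" and s0q: "\<And>c. s0 c = q \<or> s0 c = q + 1"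
    using equitable_class_sizes_exist[OF k] unfolding q_def by blast
  note min_iff = minimal_weak_maximizer_iff[OF n assms(3)]
  show ?thesis
  proof (intro conjI impI)
    assume "even n"
    define a where "a = int ((q + 1) div 2)"
    have touch: "\<bar>int (s0 c) - 2 * a\<bar> \<le> 1" for c
      using s0q[of c] unfolding a_def by (intro within_one_of_even) auto
    have "0 < n" using n by simp
    note tangent = max_wiener8_tangent_even[OF \<open>even n\<close> this, where a = a]
    show "color_wiener ?G k f = Min (color_wiener ?G k ` weak_maximizers ?G k)
        \<longleftrightarrow> color_type ?G k f \<in> shift_closure k {equitable_tuple n k}"
      unfolding min_iff minimal_sum_iff_on_tangent[OF tangent s0 touch s]
        equitable_tuple_shift_closure_iff[OF k length_color_type sorted_color_type sum] q_def[symmetric] a_def[symmetric]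
      by (simp add: set_color_type)
  next
    assume odd: "odd n"
    have q: "1 \<le> q" unfolding q_def using k by (simp add: div_greater_zero_iff Suc_le_eq)
    have "2 * q \<le> k * q" using assms(1) by simp
    also have "k * q \<le> n" by (simp add: q_def)
    finally have "q + 1 < n" using q odd by presburger
    note tangent = max_wiener8_tangent_odd[OF odd q this]
    have "(\<forall>c\<in>{1..k}. ?s c = q \<or> ?s c = q + 1) \<longleftrightarrow> (\<forall>i\<in>{1..k}. \<forall>j\<in>{1..k}. \<bar>int (?s i) - int (?s j)\<bar> \<le> 1)"
    proof
      assume two: "\<forall>c\<in>{1..k}. ?s c = q \<or> ?s c = q + 1"
      show "\<forall>i\<in>{1..k}. \<forall>j\<in>{1..k}. \<bar>int (?s i) - int (?s j)\<bar> \<le> 1"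
      proof (intro ballI)
        fix i j assume "i \<in> {1..k}" "j \<in> {1..k}"
        then have "?s i = q \<or> ?s i = q + 1" "?s j = q \<or> ?s j = q + 1" using two by blast+
        then show "\<bar>int (?s i) - int (?s j)\<bar> \<le> 1" by auto
      qed
    next
      assume "\<forall>i\<in>{1..k}. \<forall>j\<in>{1..k}. \<bar>int (?s i) - int (?s j)\<bar> \<le> 1"
      then have "\<bar>x - y\<bar> \<le> 1" if "x \<in> set (color_type ?G k f)" "y \<in> set (color_type ?G k f)" for x y
        using that by (auto simp: set_color_type)
      then have entry: "x = int q \<or> x = int q + 1" if "x \<in> set (color_type ?G k f)" for x
        using equitable_entries[OF length_color_type k(1) sum] that unfolding q_def by blast
      show "\<forall>c\<in>{1..k}. ?s c = q \<or> ?s c = q + 1"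
      proof
        fix c assume "c \<in> {1..k}"
        then have "int (?s c) \<in> set (color_type ?G k f)" by (auto simp: set_color_type)
        then show "?s c = q \<or> ?s c = q + 1" using entry by fastforce
      qed
    qed
    then show "color_wiener ?G k f = Min (color_wiener ?G k ` weak_maximizers ?G k)
        \<longleftrightarrow> (\<forall>i\<in>{1..k}. \<forall>j\<in>{1..k}. \<bar>int (?s i) - int (?s j)\<bar> \<le> 1)"
      unfolding min_iff minimal_sum_iff_on_tangent[OF tangent s0 s0q s] .
  qed
qed

end
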